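(* Let $X'$ be a visual Gromov hyperbolic metric space such that its boundary at infinity $\partial_\infty X'$, equipped with a visual metric, is a doubling metric space, and let $n=\operatorname{cdim}\partial_\infty X'<\infty$ be the capacity dimension of this boundary. Then $X'$ admits a quasi-isometric embedding into the product of $n+1$ copies of the binary metric tree (with the $\ell_1$ product metric).
   Context: Gromov product: $(x|y)_z=\frac12(|zx|+|zy|-|xy|)$. A triple $(a_1,a_2,a_3)$ of reals is a $\delta$-triple if $a_\mu\ge\min\{a_{\mu+1},a_{\mu+2}\}-\delta$ for $\mu=1,2,3$ (indices mod 3). $X$ is $\delta$-hyperbolic if $((x|y)_o,(y|z)_o,(x|z)_o)$ is a $\delta$-triple for all $o,x,y,z$; hyperbolic if $\delta$-hyperbolic for some $\delta\ge0$. A sequence $(x_i)$ converges to infinity if $(x_i|x_j)_o\to\infty$ as $i,j\to\infty$; two such sequences are equivalent if $(x_i|x'_i)_o\to\infty$; $\partial_\infty X$ is the set of equivalence classes. For $\xi,\xi'\in\partial_\infty X$, $(\xi|\xi')_o=\inf\liminf_i(x_i|x'_i)_o$ over representatives. A metric $d$ on $\partial_\infty X$ is visual if there are $o\in X$, $a>1$, $c_1,c_2>0$ with $c_1a^{-(\xi|\xi')_o}\le d(\xi,\xi')\le c_2a^{-(\xi|\xi')_o}$. A hyperbolic space $Y$ is visual if for some $o\in Y$ there is $D>0$ such that for every $y\in Y$ there is $\xi\in\partial_\infty Y$ with $|oy|\le(y|\xi)_o+D$. A metric space is doubling if there is $C\ge1$ such that every ball of radius $\rho$ can be covered by at most $C$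 balls of radius $\rho/2$. Capacity dimension: for a family $\mathcal U$ of subsets of a metric space $Z$, $\operatorname{mesh}\mathcal U=\sup_{U\in\mathcal U}\operatorname{diam}U$. An open covering $\mathcal U$ is $m$-colored if $\mathcal U=\bigcup_{c\in C}\mathcal U^c$ with $|C|=m$ and each $\mathcal U^c$ consists of pairwise disjoint sets. For an open covering, $L(\mathcal U,z)=\min\{\sup_{U\in\mathcal U}\operatorname{dist}(z,Z\setminus U),\operatorname{mesh}\mathcal U\}$ and $L(\mathcal U)=\inf_{z\in Z}L(\mathcal U,z)$. The capacity dimension $\operatorname{cdim}Z$ is the minimal integer $m\ge0$ such that there is $\delta>0$ so that for every sufficiently small $\tau>0$ there exists an $(m+1)$-colored open covering $\mathcal U$ of $Z$ with $\operatorname{mesh}\mathcal U\le\tau$ and $L(\mathcal U)\ge\delta\tau$. The binary metric tree is the simplicial tree with all vertices of valence 3 and edges of length 1; a quasi-isometric embedding is a map $f$ with $a_1|xx'|-b\le|f(x)f(x')|\le a_2|xx'|+b$ for constants $a_1,a_2>0,b\ge0$. *)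

theory Defs
  imports "HOL-Analysis.Analysis"
begin

definition gromov :: "'a::metric_space \<Rightarrow> 'a \<Rightarrow> 'a \<Rightarrow> real" where
  "gromov z x y = (dist z x + dist z y - dist x y) / 2"

definition delta_triple :: "real \<Rightarrow> real \<Rightarrow> real \<Rightarrow> real \<Rightarrow> bool" where
  "delta_triple \<delta> a1 a2 a3 \<longleftrightarrow>
     a1 \<ge> min a2 a3 - \<delta> \<and> a2 \<ge> min a3 a1 - \<delta> \<and> a3 \<ge> min a1 a2 - \<delta>"

definition delta_hyperbolic :: "'a::metric_space itself \<Rightarrow> real \<Rightarrow> bool" where
  "delta_hyperbolic T \<delta> \<longleftrightarrow>
     (\<forall>bp x y z::'a. delta_triple \<delta> (gromov bp x y) (gromov bp y z) (gromov bp x z))"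

definition hyperbolic :: "'a::metric_space itself \<Rightarrow> bool" where
  "hyperbolic T \<longleftrightarrow> (\<exists>\<delta>\<ge>0. delta_hyperbolic T \<delta>)"

text \<open>Convergence to infinity and equivalence; these notions do not depend on the
  base point, we quantify over all base points.\<close>

definition conv_inf :: "(nat \<Rightarrow> 'a::metric_space) \<Rightarrow> bool" where
  "conv_inf x \<longleftrightarrow> (\<forall>bp M. \<exists>N. \<forall>i\<ge>N. \<forall>j\<ge>N. gromov bp (x i) (x j) > M)"

definition seq_equiv :: "(nat \<Rightarrow> 'a::metric_space) \<Rightarrow> (nat \<Rightarrow> 'a) \<Rightarrow> bool" where
  "seq_equiv x x' \<longleftrightarrow> (\<forall>bp M. \<exists>N. \<forall>i\<ge>N. gromov bp (x i) (x' i) > M)"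

definition boundary :: "'a::metric_space itself \<Rightarrow> (nat \<Rightarrow> 'a) set set" where
  "boundary T = {{y. conv_inf y \<and> seq_equiv x y} | x. conv_inf x}"

definition gromov_bdry :: "'a::metric_space \<Rightarrow> (nat \<Rightarrow> 'a) set \<Rightarrow> (nat \<Rightarrow> 'a) set \<Rightarrow> ereal" where
  "gromov_bdry bp \<xi> \<xi>' = (INF x\<in>\<xi>. INF x'\<in>\<xi>'. liminf (\<lambda>i. ereal (gromov bp (x i) (x' i))))"

definition gromov_pt_bdry :: "'a::metric_space \<Rightarrow> 'a \<Rightarrow> (nat \<Rightarrow> 'a) set \<Rightarrow> ereal" where
  "gromov_pt_bdry bp y \<xi> = (INF x\<in>\<xi>. liminf (\<lambda>i. ereal (gromov bp y (x i))))"

definition apow :: "real \<Rightarrow> ereal \<Rightarrow> real" where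
  "apow a p = (if p = \<infinity> then 0 else a powr (- real_of_ereal p))"

definition metric_on :: "'b set \<Rightarrow> ('b \<Rightarrow> 'b \<Rightarrow> real) \<Rightarrow> bool" where
  "metric_on B d \<longleftrightarrow>
     (\<forall>x\<in>B. \<forall>y\<in>B. (d x y = 0 \<longleftrightarrow> x = y) \<and> d x y = d y x) \<and>
     (\<forall>x\<in>B. \<forall>y\<in>B. \<forall>z\<in>B. d x z \<le> d x y + d y z)"

definition visual_metric :: "'a::metric_space itself \<Rightarrow> ((nat \<Rightarrow> 'a) set \<Rightarrow> (nat \<Rightarrow> 'a) set \<Rightarrow> real) \<Rightarrow> bool" where
  "visual_metric T d \<longleftrightarrow> metric_on (boundary T) d \<and>
     (\<exists>(bp::'a) a c1 c2. a > 1 \<and> c1 > 0 \<and> c2 > 0 \<and>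
        (\<forall>\<xi>\<in>boundary T. \<forall>\<xi>'\<in>boundary T.
           c1 * apow a (gromov_bdry bp \<xi> \<xi>') \<le> d \<xi> \<xi>' \<and> d \<xi> \<xi>' \<le> c2 * apow a (gromov_bdry bp \<xi> \<xi>')))"

definition visual_space :: "'a::metric_space itself \<Rightarrow> bool" where
  "visual_space T \<longleftrightarrow> (\<exists>bp::'a. \<exists>D>0. \<forall>y::'a. \<exists>\<xi>\<in>boundary T.
       ereal (dist bp y) \<le> gromov_pt_bdry bp y \<xi> + ereal D)"

definition mball :: "'b set \<Rightarrow> ('b \<Rightarrow> 'b \<Rightarrow> real) \<Rightarrow> 'b \<Rightarrow> real \<Rightarrow> 'b set" where
  "mball B d c r = {z\<in>B. d c z < r}"

definition doubling :: "'b set \<Rightarrow> ('b \<Rightarrow> 'b \<Rightarrow> real) \<Rightarrow> bool" where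
  "doubling B d \<longleftrightarrow> (\<exists>C\<ge>1. \<forall>c\<in>B. \<forall>\<rho>>0. \<exists>S\<subseteq>B. finite S \<and> real (card S) \<le> C \<and>
       mball B d c \<rho> \<subseteq> (\<Union>s\<in>S. mball B d s (\<rho>/2)))"

definition open_in_m :: "'b set \<Rightarrow> ('b \<Rightarrow> 'b \<Rightarrow> real) \<Rightarrow> 'b set \<Rightarrow> bool" where
  "open_in_m B d U \<longleftrightarrow> U \<subseteq> B \<and> (\<forall>z\<in>U. \<exists>r>0. mball B d z r \<subseteq> U)"

definition open_covering :: "'b set \<Rightarrow> ('b \<Rightarrow> 'b \<Rightarrow> real) \<Rightarrow> 'b set set \<Rightarrow> bool" where
  "open_covering B d \<U> \<longleftrightarrow> (\<forall>U\<in>\<U>. open_in_m B d U) \<and> \<Union>\<U> = B"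

definition colored :: "nat \<Rightarrow> 'b set set \<Rightarrow> bool" where
  "colored m \<U> \<longleftrightarrow> (\<exists>col :: 'b set \<Rightarrow> nat. (\<forall>U\<in>\<U>. col U < m) \<and>
       (\<forall>U\<in>\<U>. \<forall>V\<in>\<U>. U \<noteq> V \<and> col U = col V \<longrightarrow> U \<inter> V = {}))"

definition mdiam :: "('b \<Rightarrow> 'b \<Rightarrow> real) \<Rightarrow> 'b set \<Rightarrow> ereal" where
  "mdiam d U = (if U = {} then 0 else (SUP x\<in>U. SUP y\<in>U. ereal (d x y)))"

definition mesh :: "('b \<Rightarrow> 'b \<Rightarrow> real) \<Rightarrow> 'b set set \<Rightarrow> ereal" where
  "mesh d \<U> = (SUP U\<in>\<U>. mdiam d U)"

definition dist_compl :: "'b set \<Rightarrow> ('b \<Rightarrow> 'b \<Rightarrow> real) \<Rightarrow> 'b \<Rightarrow> 'b set \<Rightarrow> ereal" where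
  "dist_compl B d z U = (INF w\<in>B - U. ereal (d z w))"

definition lebesgue_pt :: "'b set \<Rightarrow> ('b \<Rightarrow> 'b \<Rightarrow> real) \<Rightarrow> 'b set set \<Rightarrow> 'b \<Rightarrow> ereal" where
  "lebesgue_pt B d \<U> z = min (SUP U\<in>\<U>. dist_compl B d z U) (mesh d \<U>)"

definition lebesgue :: "'b set \<Rightarrow> ('b \<Rightarrow> 'b \<Rightarrow> real) \<Rightarrow> 'b set set \<Rightarrow> ereal" where
  "lebesgue B d \<U> = (INF z\<in>B. lebesgue_pt B d \<U> z)"

definition cdim_cond :: "'b set \<Rightarrow> ('b \<Rightarrow> 'b \<Rightarrow> real) \<Rightarrow> nat \<Rightarrow> bool" where
  "cdim_cond B d m \<longleftrightarrow> (\<exists>\<delta>>0. \<exists>\<tau>0>0. \<forall>\<tau>. 0 < \<tau> \<and> \<tau> \<le> \<tau>0 \<longrightarrow>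
      (\<exists>\<U>. open_covering B d \<U> \<and> colored (m + 1) \<U> \<and> mesh d \<U> \<le> ereal \<tau> \<and>
           lebesgue B d \<U> \<ge> ereal (\<delta> * \<tau>)))"

definition cdim :: "'b set \<Rightarrow> ('b \<Rightarrow> 'b \<Rightarrow> real) \<Rightarrow> enat" where
  "cdim B d = (if \<exists>m. cdim_cond B d m then enat (LEAST m. cdim_cond B d m) else \<infinity>)"

text \<open>Vertices: reduced words over {0,1,2} (no two equal consecutive letters); the
  vertex w (w nonempty) is joined to its parent butlast w by an edge of length 1.
  A point (w,s) with 0 \<le> s < 1 lies on that edge at distance s from w (s = 0 if w = []).\<close>

definition reduced_word :: "nat list \<Rightarrow> bool" where
  "reduced_word w \<longleftrightarrow> set w \<subseteq> {0,1,2} \<and> (\<forall>i. Suc i < length w \<longrightarrow> w ! i \<noteq> w ! Suc i)"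

definition bin_tree :: "(nat list \<times> real) set" where
  "bin_tree = {(w, s). reduced_word w \<and> 0 \<le> s \<and> s < 1 \<and> (w = [] \<longrightarrow> s = 0)}"

fun lcp_len :: "nat list \<Rightarrow> nat list \<Rightarrow> nat" where
  "lcp_len (x # xs) (y # ys) = (if x = y then Suc (lcp_len xs ys) else 0)"
| "lcp_len _ _ = 0"

definition tree_dist :: "nat list \<times> real \<Rightarrow> nat list \<times> real \<Rightarrow> real" where
  "tree_dist p q =
     (let a = real (length (fst p)) - snd p; b = real (length (fst q)) - snd q;
          m = real (lcp_len (fst p) (fst q))
      in a + b - 2 * min a (min b m))"

definition tree_power :: "nat \<Rightarrow> (nat \<Rightarrow> nat list \<times> real) set" where
  "tree_power n = {p. \<forall>i\<le>n. p i \<in> bin_tree}"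

definition tree_power_dist :: "nat \<Rightarrow> (nat \<Rightarrow> nat list \<times> real) \<Rightarrow> (nat \<Rightarrow> nat list \<times> real) \<Rightarrow> real" where
  "tree_power_dist n p q = (\<Sum>i\<le>n. tree_dist (p i) (q i))"

definition qi_embedding :: "('a::metric_space \<Rightarrow> 'b) \<Rightarrow> 'b set \<Rightarrow> ('b \<Rightarrow> 'b \<Rightarrow> real) \<Rightarrow> bool" where
  "qi_embedding f T dT \<longleftrightarrow> (\<forall>x. f x \<in> T) \<and>
     (\<exists>a1>0. \<exists>a2>0. \<exists>b\<ge>0. \<forall>x x'.
        a1 * dist x x' - b \<le> dT (f x) (f x') \<and> dT (f x) (f x') \<le> a2 * dist x x' + b)"

end

theory Submission
  imports Defs
begin

text \<open>
  A point \<open>x\<close> of the visual space is recorded as a boundary point together with the height \<open>|ox|\<close>. For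
  every scale \<open>r ^ l\<close> the capacity dimension provides \<open>n + 1\<close> families of well separated cores that
  cover the boundary. Letting each core absorb the finer cores of its colour that it meets turns
  every colour into a hierarchy of nested or disjoint envelopes, that is, into a tree. A boundary
  point followed down to level \<open>t\<close> reads off one branch in each of these trees. Every level
  contributes an entry in at least one colour, and an envelope separates points that are far apart
  on its scale, so the \<open>n + 1\<close> branches together determine the position in the space up to
  quasi-isometry.

  These trees have unbounded valence, so the envelopes are labelled by a finite alphabet.
  Two branches that diverge must soon receive different labels. By the doubling condition the number
  of pairs of branches of length \<open>j\<close> through a given envelope is exponential in \<open>j\<close>, hence a counting
  argument in the style of Rosenfeld yields a labelling in which no such pair is labelled
  identically. Spelling the labels as reduced words gives the map into the binary trees.
\<close>

section \<open>Labellings avoiding conflicts\<close>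

text \<open>One colour may skip arbitrarily many levels, so an envelope can have unboundedly many
  children, and no finite alphabet tells siblings apart at the first entry after a branching.
  Separation is therefore demanded only of runs of \<open>j\<close> entries spread over at most
  \<open>L * j\<close> levels: there the scales differ by a factor exponential in \<open>j\<close>,
  and doubling leaves only exponentially many competitors. Sparse runs get no guarantee, which is
  harmless: below the level where two boundary points part, the \<open>n + 1\<close> colours jointly
  record every level, so one of them has a dense run, and sacrificing half of it still gives a
  linear lower bound. Positions add a second difficulty. Labels are compared by their place in the
  word, while two branches may reach the same level at different places. The thick nesting of
  envelopes limits this shift to one entry for points that are close on the scale of that level, and
  this single entry is what the window in \<open>word_dist_lower\<close> has to skip.\<close>

lemma labelling_compactness:
  fixes A :: nat and xs ys :: "'i \<Rightarrow> 'v list"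
  assumes fin: "\<And>J. J \<subseteq> I \<Longrightarrow> finite J \<Longrightarrow> \<exists>f. (\<forall>v. f v < A) \<and> (\<forall>i\<in>J. map f (xs i) \<noteq> map f (ys i))"
    and len: "\<And>i. i \<in> I \<Longrightarrow> length (xs i) = length (ys i)"
  shows "\<exists>f. (\<forall>v. f v < A) \<and> (\<forall>i\<in>I. map f (xs i) \<noteq> map f (ys i))"
proof -
  define X where "X = product_topology (\<lambda>v::'v. discrete_topology {..<A}) UNIV"
  have X: "topspace X = {f. \<forall>v. f v < A}"
    by (auto simp: X_def PiE_def Pi_def)
  have comp: "compact_space X"
    unfolding X_def by (simp add: compact_space_product_topology compact_space_discrete_topology)
  define K where "K i = {f \<in> topspace X. map f (xs i) \<noteq> map f (ys i)}" for i
  have op: "openin X {f \<in> topspace X. f u = f w}" for u w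
  proof -
    have c: "openin X {f \<in> topspace X. f v \<in> {b}}" if "b < A" for v b
      using that unfolding X_def
      by (intro openin_continuous_map_preimage[OF continuous_map_product_projection]) auto
    have "{f \<in> topspace X. f u = f w} =
        (\<Union>b\<in>{..<A}. {f \<in> topspace X. f u \<in> {b}} \<inter> {f \<in> topspace X. f w \<in> {b}})"
      by (auto simp: X)
    also have "openin X \<dots>"
      by (intro openin_Union) (auto intro!: openin_Int c[simplified] simp del: openin_topspace)
    finally show ?thesis .
  qed
  \<comment> \<open>A clash is a finite conjunction of coordinate equations, each of them an open
    condition; the lists being finite is what makes its complement closed.\<close>
  have cl: "closedin X (K i)" if "i \<in> I" for i
  proof -
    have "topspace X - K i = {f \<in> topspace X. \<forall>a\<in>{..<length (xs i)}. f (xs i ! a) = f (ys i ! a)}"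
      using len[OF that] by (auto simp: K_def list_eq_iff_nth_eq)
    also have "\<dots> = topspace X \<inter> (\<Inter>a\<in>{..<length (xs i)}. {f \<in> topspace X. f (xs i ! a) = f (ys i ! a)})"
      by auto
    also have "openin X \<dots>"
      using op by (cases "length (xs i) = 0") (auto intro!: openin_Int openin_Inter)
    finally show ?thesis by (auto simp: closedin_def K_def)
  qed
  have "topspace X \<inter> \<Inter>(K ` I) \<noteq> {}"
  proof (cases "I = {}")
    case True
    then show ?thesis using fin[of "{}"] by (auto simp: X)
  next
    case False
    have "\<Inter>(K ` I) \<noteq> {}"
      using comp unfolding compact_space_fip
    proof (elim allE[where x="K ` I"] mp)
      show "(\<forall>C\<in>K ` I. closedin X C) \<and> (\<forall>\<F>. finite \<F> \<and> \<F> \<subseteq> K ` I \<longrightarrow> \<Inter> \<F> \<noteq> {})"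
      proof (intro conjI allI impI)
        fix \<F> assume "finite \<F> \<and> \<F> \<subseteq> K ` I"
        then obtain J where J: "J \<subseteq> I" "finite J" "\<F> = K ` J"
          by (meson finite_subset_image)
        then obtain f where "\<forall>v. f v < A" "\<forall>i\<in>J. map f (xs i) \<noteq> map f (ys i)"
          using fin by blast
        then have "f \<in> \<Inter>\<F>" using J by (auto simp: K_def X)
        then show "\<Inter>\<F> \<noteq> {}" by blast
      qed (use cl in auto)
    qed
    then show ?thesis using False by (auto simp: K_def)
  qed
  then show ?thesis by (auto simp: K_def X)
qed

text \<open>An event is tested only when all its vertices lie in \<open>S\<close>, which makes
  goodness hereditary; extensional functions keep the set finite.\<close>

definition good :: "nat \<Rightarrow> 'i set \<Rightarrow> ('i \<Rightarrow> 'v list) \<Rightarrow> ('i \<Rightarrow> 'v list) \<Rightarrow> 'v set \<Rightarrow> ('v \<Rightarrow> nat) set" where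
  "good A I xs ys S = {f \<in> S \<rightarrow>\<^sub>E {..<A}. \<forall>i\<in>I. set (xs i) \<union> set (ys i) \<subseteq> S \<longrightarrow> map f (xs i) \<noteq> map f (ys i)}"

lemma finite_good: "finite S \<Longrightarrow> finite (good A I xs ys S)"
  unfolding good_def by (rule finite_subset[of _ "S \<rightarrow>\<^sub>E {..<A}"]) (auto intro: finite_PiE)

lemma good_restrict:
  assumes "f \<in> good A I xs ys S" "T \<subseteq> S"
  shows "restrict f T \<in> good A I xs ys T"
proof -
  have "map (restrict f T) (xs i) \<noteq> map (restrict f T) (ys i)"
    if "i \<in> I" "set (xs i) \<union> set (ys i) \<subseteq> T" for i
  proof -
    have "map (restrict f T) (xs i) = map f (xs i)" "map (restrict f T) (ys i) = map f (ys i)"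
      using that by auto
    moreover have "set (xs i) \<union> set (ys i) \<subseteq> S" using that assms by blast
    then have "map f (xs i) \<noteq> map f (ys i)" using assms that(1) unfolding good_def by blast
    ultimately show ?thesis by metis
  qed
  then show ?thesis using assms by (auto simp: good_def PiE_def Pi_def)
qed

text \<open>Rosenfeld's counting argument: adding one vertex multiplies the number of good labellings by at
  least \<open>A / 2\<close>. A labelling in which event \<open>i\<close> first occurs at \<open>v\<close> is determined by its values off
  the list through \<open>v\<close>, and by induction there are few of those.\<close>

lemma card_good_insert:
  fixes N A :: nat
  assumes N: "N \<ge> 1" and A: "A = 4 * N"
    and ev: "\<And>i. i \<in> I \<Longrightarrow> length (xs i) = length (ys i) \<and> xs i \<noteq> [] \<and> distinct (xs i @ ys i)"
    and cnt: "\<And>v j. finite {i \<in> I. v \<in> set (xs i @ ys i) \<and> length (xs i) = j} \<and>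
        card {i \<in> I. v \<in> set (xs i @ ys i) \<and> length (xs i) = j} \<le> N ^ j"
    and S: "finite S" "v \<notin> S"
  shows "2 * real N * card (good A I xs ys S) \<le> card (good A I xs ys (insert v S))"
  using S
proof (induction "card S" arbitrary: S v rule: less_induct)
  case less
  let ?G = "\<lambda>S. real (card (good A I xs ys S))"
  \<comment> \<open>The induction hypothesis, iterated over \<open>U\<close>: every intermediate set
    that gets enlarged is a proper subset of \<open>S\<close>.\<close>
  have mono: "(2 * real N) ^ card U * ?G T \<le> ?G (T \<union> U)"
    if "finite U" "T \<inter> U = {}" "T \<union> U \<subseteq> S" for T U
    using that
  proof (induction U rule: finite_induct)
    case (insert u U)
    have "card (T \<union> U) < card S"
      using insert less.prems by (intro psubset_card_mono) auto
    moreover have "finite (T \<union> U)" using insert less.prems by (auto intro: finite_subset)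
    ultimately have 1: "2 * real N * ?G (T \<union> U) \<le> ?G (insert u (T \<union> U))"
      using less.hyps[of "T \<union> U" u] insert by auto
    have "(2 * real N) ^ card U * ?G T \<le> ?G (T \<union> U)" using insert by auto
    then have "2 * real N * ((2 * real N) ^ card U * ?G T) \<le> 2 * real N * ?G (T \<union> U)"
      by (intro mult_left_mono) auto
    then show ?case using 1 insert by (simp add: mult.assoc)
  qed auto
  define Ext where "Ext = {f \<in> insert v S \<rightarrow>\<^sub>E {..<A}. restrict f S \<in> good A I xs ys S}"
  have finExt: "finite Ext"
  proof (rule finite_subset)
    show "Ext \<subseteq> insert v S \<rightarrow>\<^sub>E {..<A}" unfolding Ext_def by blast
    show "finite (insert v S \<rightarrow>\<^sub>E {..<A})" using less.prems by (intro finite_PiE) simp_all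
  qed
  have cardExt: "card Ext = A * card (good A I xs ys S)"
  proof -
    have upd: "restrict (g(v := b)) S = g" if "g \<in> good A I xs ys S" for g b
    proof
      fix w show "restrict (g(v := b)) S w = g w"
        using that less.prems by (cases "w \<in> S") (auto simp: good_def PiE_def extensional_def)
    qed
    have "bij_betw (\<lambda>f. (f v, restrict f S)) Ext ({..<A} \<times> good A I xs ys S)"
    proof (rule bij_betw_byWitness[where f'="\<lambda>(b, g). g(v := b)"])
      show "\<forall>f\<in>Ext. (case (f v, restrict f S) of (b, g) \<Rightarrow> g(v := b)) = f"
      proof clarsimp
        fix f assume "f \<in> Ext"
        then show "(restrict f S)(v := f v) = f"
          by (intro ext) (auto simp: Ext_def PiE_def extensional_def restrict_def)
      qed
      show "\<forall>p\<in>{..<A} \<times> good A I xs ys S. ((case p of (b, g) \<Rightarrow> g(v := b)) v,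
          restrict (case p of (b, g) \<Rightarrow> g(v := b)) S) = p"
        using upd by auto
      show "(\<lambda>f. (f v, restrict f S)) ` Ext \<subseteq> {..<A} \<times> good A I xs ys S"
        by (auto simp: Ext_def)
      have "g(v := b) \<in> insert v S \<rightarrow>\<^sub>E {..<A}" if "g \<in> good A I xs ys S" "b < A" for g b
        using that unfolding good_def by (intro PiE_I) (auto simp: PiE_def extensional_def)
      then show "(\<lambda>(b, g). g(v := b)) ` ({..<A} \<times> good A I xs ys S) \<subseteq> Ext"
        using upd by (auto simp: Ext_def)
    qed
    then show ?thesis by (simp add: bij_betw_same_card card_cartesian_product)
  qed
  define Iv where "Iv = {i \<in> I. v \<in> set (xs i @ ys i) \<and> set (xs i) \<union> set (ys i) \<subseteq> insert v S}"
  define Bad where "Bad i = {f \<in> Ext. map f (xs i) = map f (ys i)}" for i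
  define J where "J = Suc (card S)"
  define Ivj where "Ivj j = {i \<in> Iv. length (xs i) = j}" for j
  have len: "1 \<le> length (xs i) \<and> length (xs i) \<le> J" if "i \<in> Iv" for i
  proof -
    have "length (xs i) = card (set (xs i))" using ev[of i] that by (simp add: Iv_def distinct_card)
    also have "\<dots> \<le> card (insert v S)" using that less.prems by (intro card_mono) (auto simp: Iv_def)
    finally have "length (xs i) \<le> J" using less.prems by (simp add: J_def)
    moreover have "xs i \<noteq> []" using ev[of i] that by (auto simp: Iv_def)
    ultimately show ?thesis by (cases "xs i") auto
  qed
  have Ivj: "finite (Ivj j)" "card (Ivj j) \<le> N ^ j" for j
  proof -
    have sub: "Ivj j \<subseteq> {i \<in> I. v \<in> set (xs i @ ys i) \<and> length (xs i) = j}"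
      by (auto simp: Ivj_def Iv_def)
    show "finite (Ivj j)" using sub cnt finite_subset by blast
    show "card (Ivj j) \<le> N ^ j" using card_mono[OF _ sub] cnt[of v j] by linarith
  qed
  have Iv_eq: "Iv = (\<Union>j\<in>{1..J}. Ivj j)" using len by (auto simp: Ivj_def)
  have finIv: "finite Iv" unfolding Iv_eq using Ivj by auto
  have bad: "(2 * real N) ^ (length (xs i) - 1) * card (Bad i) \<le> ?G S" if i: "i \<in> Iv" for i
  proof -
    \<comment> \<open>Distinctness of \<open>xs i @ ys i\<close> puts the list that avoids
      \<open>v\<close> inside \<open>T\<close>. On the way back from \<open>T\<close> to
      \<open>S\<close> each of the remaining \<open>length (xs i) - 1\<close> vertices gains a
      factor \<open>2 * N\<close>.\<close>
    define X where "X = (if v \<in> set (xs i) then set (xs i) else set (ys i))"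
    have iI: "i \<in> I" using i by (auto simp: Iv_def)
    have vX: "v \<in> X" using i by (auto simp: Iv_def X_def)
    have XS: "X \<subseteq> insert v S" using i by (auto simp: Iv_def X_def)
    have cX: "card X = length (xs i)" using ev[OF iI] by (auto simp: X_def distinct_card)
    define T where "T = insert v S - X"
    have TS: "T \<subseteq> S" using vX by (auto simp: T_def)
    define Y where "Y = (if v \<in> set (xs i) then set (ys i) else set (xs i))"
    have YT: "Y \<subseteq> T" using i ev[OF iI] by (auto simp: Y_def T_def X_def Iv_def)
    have inj: "inj_on (\<lambda>f. restrict f T) (Bad i)"
    proof (rule inj_onI)
      fix f g assume f: "f \<in> Bad i" and g: "g \<in> Bad i" and eq: "restrict f T = restrict g T"
      have onT: "f w = g w" if "w \<in> T" for w using eq that by (metis restrict_apply')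
      have onX: "f w = g w" if "w \<in> X" for w
      proof (cases "v \<in> set (xs i)")
        case True
        then have "w \<in> set (xs i)" using that by (simp add: X_def)
        then obtain a where a: "a < length (xs i)" "w = xs i ! a"
          by (metis in_set_conv_nth)
        have "map f (xs i) ! a = map f (ys i) ! a" "map g (xs i) ! a = map g (ys i) ! a"
          using f g by (auto simp: Bad_def)
        moreover have "ys i ! a \<in> T" using YT a ev[OF iI] True by (auto simp: Y_def)
        ultimately show ?thesis using a ev[OF iI] onT by auto
      next
        case False
        then have "w \<in> set (ys i)" using that by (simp add: X_def)
        then obtain a where a: "a < length (ys i)" "w = ys i ! a"
          by (metis in_set_conv_nth)
        have "map f (xs i) ! a = map f (ys i) ! a" "map g (xs i) ! a = map g (ys i) ! a"
          using f g by (auto simp: Bad_def)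
        moreover have "xs i ! a \<in> T" using YT a ev[OF iI] False by (auto simp: Y_def)
        ultimately show ?thesis using a ev[OF iI] onT by auto
      qed
      show "f = g"
      proof
        fix w show "f w = g w"
          using f g onT[of w] onX[of w]
          by (cases "w \<in> insert v S") (auto simp: Bad_def Ext_def T_def PiE_def extensional_def)
      qed
    qed
    have "(\<lambda>f. restrict f T) ` Bad i \<subseteq> good A I xs ys T"
    proof clarify
      fix f assume "f \<in> Bad i"
      then have "restrict (restrict f S) T \<in> good A I xs ys T"
        using TS by (intro good_restrict) (auto simp: Bad_def Ext_def)
      then show "restrict f T \<in> good A I xs ys T" using TS by (simp add: Int_absorb1)
    qed
    moreover have "finite (good A I xs ys T)"
      using TS less.prems by (intro finite_good) (auto intro: finite_subset)
    ultimately have "card (Bad i) \<le> card (good A I xs ys T)"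
      using inj by (metis card_inj_on_le)
    moreover have "(2 * real N) ^ card (X - {v}) * ?G T \<le> ?G (T \<union> (X - {v}))"
      using XS vX less.prems by (intro mono) (auto simp: T_def intro: finite_subset)
    moreover have "T \<union> (X - {v}) = S" using XS vX less.prems by (auto simp: T_def)
    moreover have "card (X - {v}) = length (xs i) - 1" using vX cX by auto
    ultimately show ?thesis
      by (smt (verit) mult_left_mono of_nat_0_le_iff of_nat_le_iff zero_le_power zero_le_mult_iff)
  qed
  have "Ext - (\<Union>i\<in>Iv. Bad i) \<subseteq> good A I xs ys (insert v S)"
  proof
    fix f assume f: "f \<in> Ext - (\<Union>i\<in>Iv. Bad i)"
    have "map f (xs i) \<noteq> map f (ys i)" if i: "i \<in> I" "set (xs i) \<union> set (ys i) \<subseteq> insert v S" for i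
    proof (cases "v \<in> set (xs i @ ys i)")
      case True
      then show ?thesis using f i by (auto simp: Iv_def Bad_def)
    next
      case False
      then have s: "set (xs i) \<union> set (ys i) \<subseteq> S" using i by auto
      then have "map (restrict f S) (xs i) \<noteq> map (restrict f S) (ys i)"
        using f i by (auto simp: Ext_def good_def)
      moreover have "map (restrict f S) (xs i) = map f (xs i)" "map (restrict f S) (ys i) = map f (ys i)"
        using s by auto
      ultimately show ?thesis by simp
    qed
    then show "f \<in> good A I xs ys (insert v S)" using f by (auto simp: good_def Ext_def)
  qed
  then have "card (Ext - (\<Union>i\<in>Iv. Bad i)) \<le> card (good A I xs ys (insert v S))"
    using less.prems by (intro card_mono finite_good) auto
  moreover have "card Ext - card (\<Union>i\<in>Iv. Bad i) \<le> card (Ext - (\<Union>i\<in>Iv. Bad i))"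
    using finIv finExt by (intro diff_card_le_card_Diff) (auto simp: Bad_def)
  moreover have "card (\<Union>i\<in>Iv. Bad i) \<le> (\<Sum>i\<in>Iv. card (Bad i))"
    using finIv by (rule card_UN_le)
  ultimately have "card Ext \<le> card (good A I xs ys (insert v S)) + (\<Sum>i\<in>Iv. card (Bad i))"
    by linarith
  then have "real (card Ext) \<le> real (card (good A I xs ys (insert v S)) + (\<Sum>i\<in>Iv. card (Bad i)))"
    by (rule of_nat_mono)
  then have 1: "real (card Ext) - (\<Sum>i\<in>Iv. real (card (Bad i))) \<le> ?G (insert v S)"
    by simp
  \<comment> \<open>At most \<open>N ^ j\<close> events of length \<open>j\<close> each spoil at
    most the fraction \<open>1 / (2 * N) ^ (j - 1)\<close> of \<open>?G S\<close>. The geometric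
    series keeps the total loss below \<open>2 * N * ?G S\<close>, half of the \<open>4 * N\<close>
    extensions per labelling.\<close>
  have "(\<Sum>i\<in>Iv. real (card (Bad i))) \<le> (\<Sum>i\<in>Iv. ?G S / (2 * real N) ^ (length (xs i) - 1))"
    using bad N by (intro sum_mono) (simp add: field_simps)
  also have "\<dots> = (\<Sum>j\<in>{1..J}. \<Sum>i\<in>Ivj j. ?G S / (2 * real N) ^ (length (xs i) - 1))"
    unfolding Iv_eq by (rule sum.UNION_disjoint) (use Ivj in \<open>auto simp: Ivj_def\<close>)
  also have "\<dots> = (\<Sum>j\<in>{1..J}. real (card (Ivj j)) * (?G S / (2 * real N) ^ (j - 1)))"
    by (intro sum.cong) (auto simp: Ivj_def)
  also have "\<dots> \<le> (\<Sum>j\<in>{1..J}. real (N ^ j) * (?G S / (2 * real N) ^ (j - 1)))"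
    using Ivj by (intro sum_mono mult_right_mono) (auto simp del: of_nat_power)
  also have "\<dots> = (\<Sum>j\<in>{1..J}. 2 * real N * ?G S * (1/2) ^ j)"
  proof (rule sum.cong)
    fix j assume "j \<in> {1..J}"
    then obtain j' where "j = Suc j'" by (cases j) auto
    then show "real (N ^ j) * (?G S / (2 * real N) ^ (j - 1)) = 2 * real N * ?G S * (1/2) ^ j"
      using N by (simp add: field_simps power_mult_distrib)
  qed simp
  also have "\<dots> = 2 * real N * ?G S * (\<Sum>j\<in>{1..J}. (1/2) ^ j)"
    by (simp add: sum_distrib_left)
  also have "(\<Sum>j\<in>{1..J}. (1/2::real) ^ j) = 1 - (1/2) ^ J" by (induction J) auto
  also have "2 * real N * ?G S * (1 - (1/2) ^ J) \<le> 2 * real N * ?G S * 1"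
    by (intro mult_left_mono) auto
  finally show ?case using 1 cardExt A by (simp add: algebra_simps)
qed

text \<open>The empty labelling is good, and each insertion keeps the count positive; compactness
  then passes from finite sets of events to all of them.\<close>

lemma exists_labelling:
  fixes N :: nat and xs ys :: "'i \<Rightarrow> 'v list"
  assumes N: "N \<ge> 1"
    and ev: "\<And>i. i \<in> I \<Longrightarrow> length (xs i) = length (ys i) \<and> xs i \<noteq> [] \<and> distinct (xs i @ ys i)"
    and cnt: "\<And>v j. finite {i \<in> I. v \<in> set (xs i @ ys i) \<and> length (xs i) = j} \<and>
        card {i \<in> I. v \<in> set (xs i @ ys i) \<and> length (xs i) = j} \<le> N ^ j"
  shows "\<exists>f :: 'v \<Rightarrow> nat. (\<forall>v. f v < 4 * N) \<and> (\<forall>i\<in>I. map f (xs i) \<noteq> map f (ys i))"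
proof (rule labelling_compactness)
  fix J assume J: "J \<subseteq> I" "finite J"
  let ?G = "\<lambda>S. good (4 * N) I xs ys S"
  have pos: "card (?G S) > 0" if "finite S" for S
    using that
  proof (induction S rule: finite_induct)
    case empty
    have "?G {} = {\<lambda>_. undefined}" using ev by (fastforce simp: good_def)
    then show ?case by simp
  next
    case (insert v S)
    then have "2 * real N * card (?G S) > 0" using N by simp
    then show ?case using card_good_insert[OF N refl ev cnt insert(1,2)] by simp
  qed
  define S where "S = (\<Union>i\<in>J. set (xs i) \<union> set (ys i))"
  have "finite S" using J by (simp add: S_def)
  then obtain f where f: "f \<in> ?G S" using pos[of S] by fastforce
  \<comment> \<open>Vertices outside \<open>S\<close> occur in no event of \<open>J\<close>; the
    value \<open>0\<close> merely makes the labelling total.\<close>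
  define g where "g v = (if v \<in> S then f v else 0)" for v
  have "map g (xs i) = map f (xs i)" "map g (ys i) = map f (ys i)" if "i \<in> J" for i
    using that by (auto simp: g_def S_def)
  moreover have "map f (xs i) \<noteq> map f (ys i)" if "i \<in> J" for i
    using f J that by (auto simp: good_def S_def)
  moreover have "g v < 4 * N" for v using f N by (auto simp: g_def good_def)
  ultimately show "\<exists>f. (\<forall>v. f v < 4 * N) \<and> (\<forall>i\<in>J. map f (xs i) \<noteq> map f (ys i))"
    by (intro exI[of _ g]) metis
qed (use ev in auto)

section \<open>Nested envelopes from the capacity dimension\<close>

locale metric_carrier =
  fixes B :: "'b set" and d :: "'b \<Rightarrow> 'b \<Rightarrow> real"
  assumes metric: "metric_on B d"
begin

lemma d_refl [simp]: "x \<in> B \<Longrightarrow> d x x = 0"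
  and d_sym: "x \<in> B \<Longrightarrow> y \<in> B \<Longrightarrow> d x y = d y x"
  and d_tri: "x \<in> B \<Longrightarrow> y \<in> B \<Longrightarrow> z \<in> B \<Longrightarrow> d x z \<le> d x y + d y z"
  using metric unfolding metric_on_def by blast+

section \<open>Separated sets in doubling spaces\<close>

lemma cover_mball:
  assumes C: "\<forall>c\<in>B. \<forall>\<rho>>0. \<exists>S\<subseteq>B. finite S \<and> real (card S) \<le> real C \<and>
       mball B d c \<rho> \<subseteq> (\<Union>s\<in>S. mball B d s (\<rho>/2))"
    and c: "c \<in> B" and \<rho>: "\<rho> > 0"
  shows "\<exists>S\<subseteq>B. finite S \<and> card S \<le> C ^ i \<and> mball B d c \<rho> \<subseteq> (\<Union>s\<in>S. mball B d s (\<rho> / 2 ^ i))"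
proof (induction i)
  case 0
  then show ?case using c by (intro exI[of _ "{c}"]) auto
next
  case (Suc i)
  then obtain S where S: "S \<subseteq> B" "finite S" "card S \<le> C ^ i"
    "mball B d c \<rho> \<subseteq> (\<Union>s\<in>S. mball B d s (\<rho> / 2 ^ i))" by blast
  have "\<forall>s\<in>S. \<exists>S'\<subseteq>B. finite S' \<and> card S' \<le> C \<and>
      mball B d s (\<rho> / 2 ^ i) \<subseteq> (\<Union>s'\<in>S'. mball B d s' (\<rho> / 2 ^ i / 2))"
    using C S(1) \<rho> by (metis of_nat_le_iff subsetD zero_less_divide_iff zero_less_numeral zero_less_power)
  then obtain S' where S': "\<And>s. s \<in> S \<Longrightarrow> S' s \<subseteq> B \<and> finite (S' s) \<and> card (S' s) \<le> C \<and>
      mball B d s (\<rho> / 2 ^ i) \<subseteq> (\<Union>s'\<in>S' s. mball B d s' (\<rho> / 2 ^ i / 2))" by metis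
  have "card (\<Union>(S' ` S)) \<le> (\<Sum>s\<in>S. card (S' s))" using S(2) by (rule card_UN_le)
  also have "\<dots> \<le> card S * C" using S' by (metis sum_bounded_above of_nat_id)
  also have "\<dots> \<le> C ^ Suc i" using S(3) by simp
  finally have "card (\<Union>(S' ` S)) \<le> C ^ Suc i" .
  moreover have "mball B d c \<rho> \<subseteq> (\<Union>s\<in>\<Union>(S' ` S). mball B d s (\<rho> / 2 ^ Suc i))"
  proof
    fix x assume "x \<in> mball B d c \<rho>"
    then obtain s where s: "s \<in> S" "x \<in> mball B d s (\<rho> / 2 ^ i)" using S(4) by blast
    then obtain s' where "s' \<in> S' s" "x \<in> mball B d s' (\<rho> / 2 ^ i / 2)" using S' by blast
    then show "x \<in> (\<Union>s\<in>\<Union>(S' ` S). mball B d s (\<rho> / 2 ^ Suc i))"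
      using s by (auto simp: mult.commute)
  qed
  moreover have "\<Union>(S' ` S) \<subseteq> B" "finite (\<Union>(S' ` S))" using S(2) S' by blast+
  ultimately show ?case by blast
qed

text \<open>Each of the at most \<open>C ^ i\<close> balls of radius \<open>\<rho> / 2 ^ i\<close>
  holds at most one point of \<open>Y\<close>, because two points of one ball are less than twice
  the radius apart.\<close>

lemma card_separated:
  assumes C: "\<forall>c\<in>B. \<forall>\<rho>>0. \<exists>S\<subseteq>B. finite S \<and> real (card S) \<le> real C \<and>
       mball B d c \<rho> \<subseteq> (\<Union>s\<in>S. mball B d s (\<rho>/2))"
    and c: "c \<in> B" and \<rho>: "\<rho> > 0"
    and Y: "Y \<subseteq> mball B d c \<rho>"
    and sep: "\<And>x y. x \<in> Y \<Longrightarrow> y \<in> Y \<Longrightarrow> x \<noteq> y \<Longrightarrow> 2 * \<rho> / 2 ^ i \<le> d x y"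
  shows "finite Y \<and> card Y \<le> C ^ i"
proof -
  obtain S where S: "S \<subseteq> B" "finite S" "card S \<le> C ^ i"
    "mball B d c \<rho> \<subseteq> (\<Union>s\<in>S. mball B d s (\<rho> / 2 ^ i))"
    using cover_mball[OF C c \<rho>] by blast
  have "\<forall>y\<in>Y. \<exists>s\<in>S. y \<in> mball B d s (\<rho> / 2 ^ i)" using S(4) Y by blast
  then obtain g where g: "\<And>y. y \<in> Y \<Longrightarrow> g y \<in> S \<and> y \<in> mball B d (g y) (\<rho> / 2 ^ i)" by metis
  have "inj_on g Y"
  proof (rule inj_onI, rule ccontr)
    fix x y assume xy: "x \<in> Y" "y \<in> Y" "g x = g y" "x \<noteq> y"
    have in_B: "x \<in> B" "y \<in> B" "g x \<in> B" using g xy S(1) by (auto simp: mball_def)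
    have "d x y \<le> d (g x) x + d (g x) y" using d_tri[of x "g x" y] d_sym[of x "g x"] in_B by simp
    also have "\<dots> < 2 * \<rho> / 2 ^ i" using g[of x] g[of y] xy by (auto simp: mball_def)
    finally show False using sep xy by force
  qed
  moreover have "g ` Y \<subseteq> S" using g by blast
  ultimately show ?thesis
    using S card_inj_on_le finite_imageD finite_subset by (metis le_trans)
qed

section \<open>Separated cores from coloured coverings\<close>

definition core_cover :: "nat \<Rightarrow> real \<Rightarrow> real \<Rightarrow> (nat \<Rightarrow> 'b set set) \<Rightarrow> bool" where
  "core_cover n \<beta> \<tau> Q \<longleftrightarrow>
    (\<forall>c. \<forall>V\<in>Q c. V \<noteq> {} \<and> V \<subseteq> B \<and> (\<forall>x\<in>V. \<forall>y\<in>V. d x y \<le> \<tau>)) \<and>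
    (\<forall>c. \<forall>V\<in>Q c. \<forall>W\<in>Q c. V \<noteq> W \<longrightarrow> (\<forall>x\<in>V. \<forall>y\<in>W. d x y > \<beta> * \<tau>)) \<and>
    (\<forall>z\<in>B. \<exists>c\<le>n. \<exists>V\<in>Q c. z \<in> V)"

text \<open>Members of one colour are merely disjoint. Shrinking each to the points whose
  \<open>\<beta> * \<tau>\<close>-neighbourhood it contains makes them separated, and the Lebesgue
  number guarantees that the shrunken sets still cover.\<close>

lemma cdim_cores:
  assumes "cdim_cond B d n"
  shows "\<exists>T>0. \<exists>\<beta>>0. \<beta> \<le> 1 \<and> (\<forall>\<tau>. 0 < \<tau> \<and> \<tau> \<le> T \<longrightarrow> (\<exists>Q. core_cover n \<beta> \<tau> Q))"
proof -
  obtain \<delta> T where \<delta>: "\<delta> > 0" "T > 0" and cov: "\<And>\<tau>. 0 < \<tau> \<and> \<tau> \<le> T \<Longrightarrow>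
      \<exists>\<U>. open_covering B d \<U> \<and> colored (n + 1) \<U> \<and> mesh d \<U> \<le> ereal \<tau> \<and>
           lebesgue B d \<U> \<ge> ereal (\<delta> * \<tau>)"
    using assms unfolding cdim_cond_def by blast
  \<comment> \<open>Strictly below \<open>\<delta>\<close>, so that the supremum in the Lebesgue
    number exceeds \<open>\<beta> * \<tau>\<close> and hence some single member does; the cap
    \<open>1\<close> later bounds the ratio of the scales.\<close>
  define \<beta> where "\<beta> = min 1 (\<delta> / 2)"
  have \<beta>: "\<beta> > 0" "\<beta> \<le> 1" "\<beta> < \<delta>" using \<delta> by (auto simp: \<beta>_def)
  have "\<exists>Q. core_cover n \<beta> \<tau> Q" if \<tau>: "0 < \<tau>" "\<tau> \<le> T" for \<tau>
  proof -
    obtain \<U> where \<U>: "open_covering B d \<U>" "colored (n + 1) \<U>" "mesh d \<U> \<le> ereal \<tau>"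
      "lebesgue B d \<U> \<ge> ereal (\<delta> * \<tau>)" using cov \<tau> by blast
    obtain col :: "'b set \<Rightarrow> nat" where col0: "(\<forall>U\<in>\<U>. col U < n + 1) \<and>
       (\<forall>U\<in>\<U>. \<forall>V\<in>\<U>. U \<noteq> V \<and> col U = col V \<longrightarrow> U \<inter> V = {})"
      using \<U>(2) unfolding colored_def by (elim exE)
    have col: "col U < n + 1" "V \<in> \<U> \<Longrightarrow> U \<noteq> V \<Longrightarrow> col U = col V \<Longrightarrow> U \<inter> V = {}"
      if "U \<in> \<U>" for U V using col0 that by simp_all
    define core where "core U = {z \<in> U. \<forall>w\<in>B. d z w \<le> \<beta> * \<tau> \<longrightarrow> w \<in> U}" for U
    define Q where "Q c = {core U | U. U \<in> \<U> \<and> col U = c \<and> core U \<noteq> {}}" for c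
    have UB: "U \<subseteq> B" if "U \<in> \<U>" for U using \<U>(1) that by (auto simp: open_covering_def)
    have diam: "d x y \<le> \<tau>" if "U \<in> \<U>" "x \<in> U" "y \<in> U" for U x y
    proof -
      have "ereal (d x y) \<le> (SUP y\<in>U. ereal (d x y))" using that by (intro SUP_upper)
      also have "\<dots> \<le> (SUP x\<in>U. SUP y\<in>U. ereal (d x y))" using that(2) by (rule SUP_upper)
      also have "\<dots> = mdiam d U" using that by (auto simp: mdiam_def)
      also have "\<dots> \<le> mesh d \<U>" unfolding mesh_def using that(1) by (rule SUP_upper)
      also have "\<dots> \<le> ereal \<tau>" by (rule \<U>(3))
      finally show ?thesis by simp
    qed
    have sep: "d x y > \<beta> * \<tau>"
      if "U \<in> \<U>" "V \<in> \<U>" "col U = col V" "core U \<noteq> core V" "x \<in> core U" "y \<in> core V" for U V x y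
    proof (rule ccontr)
      assume le: "\<not> d x y > \<beta> * \<tau>"
      have "y \<in> V" using that(6) unfolding core_def by blast
      then have "y \<in> B" using UB[OF that(2)] by blast
      then have "y \<in> U" using that(5) le unfolding core_def by (simp add: not_less)
      moreover have "U \<noteq> V" using that(4) by blast
      ultimately show False using col(2)[OF that(1,2)] that(3) \<open>y \<in> V\<close> by blast
    qed
    have cover: "\<exists>c\<le>n. \<exists>V\<in>Q c. z \<in> V" if z: "z \<in> B" for z
    proof -
      have "ereal (\<beta> * \<tau>) < ereal (\<delta> * \<tau>)" using \<beta> \<tau> by simp
      also have "\<dots> \<le> lebesgue B d \<U>" by (rule \<U>(4))
      also have "\<dots> \<le> lebesgue_pt B d \<U> z" unfolding lebesgue_def using z by (rule INF_lower)
      also have "\<dots> \<le> (SUP U\<in>\<U>. dist_compl B d z U)" by (simp add: lebesgue_pt_def)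
      finally obtain U where U: "U \<in> \<U>" "ereal (\<beta> * \<tau>) < dist_compl B d z U"
        unfolding less_SUP_iff by blast
      have nb: "w \<in> U" if "w \<in> B" "d z w \<le> \<beta> * \<tau>" for w
      proof (rule ccontr)
        assume "w \<notin> U"
        then have "dist_compl B d z U \<le> ereal (d z w)"
          unfolding dist_compl_def using that by (intro INF_lower) auto
        then show False using U(2) that by (metis ereal_less_eq(3) leD order_trans)
      qed
      have "z \<in> U" using nb[of z] z \<beta> \<tau> by simp
      then have "z \<in> core U" using nb unfolding core_def by blast
      then have "core U \<in> Q (col U)" using U(1) unfolding Q_def by blast
      then show ?thesis using \<open>z \<in> core U\<close> col(1)[OF U(1)] by (metis Suc_eq_plus1 less_Suc_eq_le)
    qed
    have Q1: "\<forall>c. \<forall>V\<in>Q c. V \<noteq> {} \<and> V \<subseteq> B \<and> (\<forall>x\<in>V. \<forall>y\<in>V. d x y \<le> \<tau>)"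
    proof (intro allI ballI)
      fix c V assume "V \<in> Q c"
      then obtain U where U: "U \<in> \<U>" "V = core U" "core U \<noteq> {}" unfolding Q_def by blast
      then have "V \<subseteq> U" unfolding core_def by blast
      then show "V \<noteq> {} \<and> V \<subseteq> B \<and> (\<forall>x\<in>V. \<forall>y\<in>V. d x y \<le> \<tau>)"
        using U UB[OF U(1)] diam[OF U(1)] by blast
    qed
    have Q2: "\<forall>c. \<forall>V\<in>Q c. \<forall>W\<in>Q c. V \<noteq> W \<longrightarrow> (\<forall>x\<in>V. \<forall>y\<in>W. d x y > \<beta> * \<tau>)"
    proof (intro allI ballI impI)
      fix c V W x y assume "V \<in> Q c" "W \<in> Q c" and *: "V \<noteq> W" "x \<in> V" "y \<in> W"
      then obtain U U' where "U \<in> \<U>" "col U = c" "V = core U" "U' \<in> \<U>" "col U' = c" "W = core U'"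
        unfolding Q_def mem_Collect_eq by (elim exE conjE)
      then show "\<beta> * \<tau> < d x y" using sep[of U U' x y] * by simp
    qed
    show ?thesis unfolding core_cover_def by (intro exI[of _ Q] conjI ballI Q1 Q2 cover)
  qed
  then show ?thesis using \<beta>(1,2) \<delta>(2) by blast
qed

end

text \<open>\<open>P\<close> holds the cores of one colour at all levels. The ratio
  \<open>r \<le> \<beta> / 16\<close> makes a detour of length \<open>2 * R (Suc l)\<close> at most
  \<open>\<beta> / 8 * R l\<close>, a small part of the gap \<open>\<beta> * R l\<close> between
  cores of level \<open>l\<close>.\<close>

locale core_family = metric_carrier B d for B :: "'b set" and d +
  fixes P :: "nat \<Rightarrow> 'b set set" and R :: "nat \<Rightarrow> real" and T r \<beta> :: real
  assumes R_def: "R l = T * r ^ l"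
    and T_pos: "T > 0" and \<beta>_pos: "\<beta> > 0" and \<beta>_le: "\<beta> \<le> 1"
    and r_pos: "r > 0" and r_le: "r \<le> \<beta> / 16"
    and core_ne: "V \<in> P l \<Longrightarrow> V \<noteq> {}"
    and core_sub: "V \<in> P l \<Longrightarrow> V \<subseteq> B"
    and core_diam: "V \<in> P l \<Longrightarrow> x \<in> V \<Longrightarrow> y \<in> V \<Longrightarrow> d x y \<le> R l"
    and core_sep: "V \<in> P l \<Longrightarrow> W \<in> P l \<Longrightarrow> V \<noteq> W \<Longrightarrow> x \<in> V \<Longrightarrow> y \<in> W \<Longrightarrow> \<beta> * R l < d x y"
begin

text \<open>The envelope of a core absorbs every finer envelope that it meets, together with a neighbourhood
  whose radius is proportional to the scale of the finer one. Hence two envelopes are disjoint or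
  nested, and the nesting is thick enough for nearby points to lie in almost the same envelopes.\<close>

inductive env :: "nat \<Rightarrow> 'b set \<Rightarrow> 'b \<Rightarrow> bool" where
  base: "V \<in> P k \<Longrightarrow> x \<in> V \<Longrightarrow> env k V x"
| step: "env k V y \<Longrightarrow> env m W y \<Longrightarrow> k < m \<Longrightarrow> env m W w \<Longrightarrow> x \<in> B \<Longrightarrow>
    d w x < \<beta> / 8 * R m \<Longrightarrow> env k V x"

lemma R_pos: "R l > 0"
  using T_pos r_pos by (simp add: R_def)

lemma r_lt_1: "r < 1"
  using r_le \<beta>_le by simp

lemma R_Suc: "R (Suc l) = r * R l"
  by (simp add: R_def)

lemma R_mono: "l \<le> m \<Longrightarrow> R m \<le> R l"
  unfolding R_def using T_pos r_pos r_lt_1 by (intro mult_left_mono power_decreasing) auto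

lemma env_core: "env k V x \<Longrightarrow> V \<in> P k"
  by (induction rule: env.induct) auto

lemma env_B: "env k V x \<Longrightarrow> x \<in> B"
  by (induction rule: env.induct) (use core_sub in auto)

text \<open>Chains of links of scale at least \<open>j\<close> cannot travel far: a chain visits at most one core of
  level exactly \<open>j\<close>, because its excursions at finer levels are shorter than the gap between two
  such cores. The cut-off \<open>N\<close> makes downward induction on \<open>j\<close> possible.\<close>

definition nbhd :: "nat \<Rightarrow> 'b set \<Rightarrow> 'b set" where
  "nbhd m W = {x \<in> B. \<exists>w\<in>W. d w x \<le> \<beta> / 4 * R m}"

definition link :: "nat \<Rightarrow> nat \<Rightarrow> 'b \<Rightarrow> 'b \<Rightarrow> bool" where
  "link j N x y \<longleftrightarrow> (\<exists>m W. j \<le> m \<and> m \<le> N \<and> W \<in> P m \<and> x \<in> nbhd m W \<and> y \<in> nbhd m W)"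

lemma link_B: "(link j N)\<^sup>*\<^sup>* x y \<Longrightarrow> x \<in> B \<Longrightarrow> y \<in> B"
  by (induction rule: rtranclp_induct) (auto simp: link_def nbhd_def)

lemma nbhd_diam:
  assumes "W \<in> P m" "x \<in> nbhd m W" "y \<in> nbhd m W"
  shows "d x y \<le> (1 + \<beta> / 2) * R m"
proof -
  obtain v w where vw: "v \<in> W" "w \<in> W" "d v x \<le> \<beta> / 4 * R m" "d w y \<le> \<beta> / 4 * R m"
    and xy: "x \<in> B" "y \<in> B"
    using assms by (auto simp: nbhd_def)
  have "v \<in> B" "w \<in> B" using vw core_sub assms by auto
  then have "d x y \<le> d v x + d v w + d w y"
    using d_tri[of x v y] d_tri[of v w y] d_sym[of x v] xy by simp
  then show ?thesis using vw core_diam[OF assms(1) vw(1,2)] by (simp add: algebra_simps)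
qed

text \<open>Two neighbourhoods of radius \<open>\<beta> / 4 * R m\<close> use up only half of the
  gap between distinct cores.\<close>

lemma nbhd_unique:
  assumes "W \<in> P m" "W' \<in> P m" "x \<in> nbhd m W" "y \<in> nbhd m W'" "d x y \<le> \<beta> / 2 * R m"
  shows "W = W'"
proof (rule ccontr)
  assume ne: "W \<noteq> W'"
  obtain v w where vw: "v \<in> W" "w \<in> W'" "d v x \<le> \<beta> / 4 * R m" "d w y \<le> \<beta> / 4 * R m"
    and xy: "x \<in> B" "y \<in> B"
    using assms by (auto simp: nbhd_def)
  have "v \<in> B" "w \<in> B" using vw core_sub assms by auto
  then have "d v w \<le> d v x + d x y + d w y"
    using d_tri[of v x w] d_tri[of x y w] d_sym[of y w] xy by simp
  moreover have "\<beta> * R m < d v w" using core_sep assms ne vw by blast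
  ultimately show False using vw assms(5) by (simp add: algebra_simps)
qed

lemma linked_bounded_dist:
  assumes "(link j N)\<^sup>*\<^sup>* x y" "x \<in> B"
  shows "d x y \<le> 2 * R j"
  using assms
proof (induction "Suc N - j" arbitrary: j x y)
  case 0
  then have "\<not> link j N a b" for a b by (auto simp: link_def)
  then have "x = y" using 0 by (metis converse_rtranclpE)
  then show ?case using 0 R_pos[of j] by simp
next
  case (Suc q)
  have IH: "d a b \<le> 2 * R (Suc j)" if "(link (Suc j) N)\<^sup>*\<^sup>* a b" "a \<in> B" for a b
    using Suc.hyps(1)[of "Suc j"] Suc.hyps(2) that by simp
  \<comment> \<open>Normal form of a chain: either it stays finer than \<open>j\<close>, or it can
    be cut down to a finer chain, one jump inside the neighbourhood of a single core of level
    \<open>j\<close>, and another finer chain.\<close>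
  have "(link (Suc j) N)\<^sup>*\<^sup>* x y \<or> (\<exists>W\<in>P j. \<exists>u\<in>nbhd j W. \<exists>u'\<in>nbhd j W.
      (link (Suc j) N)\<^sup>*\<^sup>* x u \<and> (link (Suc j) N)\<^sup>*\<^sup>* u' y)"
    using Suc.prems(1)
  proof (induction rule: rtranclp_induct)
    case base
    then show ?case by simp
  next
    case (step y z)
    obtain m W' where W': "j \<le> m" "m \<le> N" "W' \<in> P m" "y \<in> nbhd m W'" "z \<in> nbhd m W'"
      using step.hyps(2) by (auto simp: link_def)
    show ?case
    proof (cases "m = j")
      case False
      then have "Suc j \<le> m" using W'(1) by simp
      then have "link (Suc j) N y z" using W' unfolding link_def by blast
      then show ?thesis using step.IH by (meson rtranclp.rtrancl_into_rtrancl)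
    next
      case True
      from step.IH show ?thesis
      proof
        assume "(link (Suc j) N)\<^sup>*\<^sup>* x y"
        then show ?thesis using True W' by blast
      next
        assume "\<exists>W\<in>P j. \<exists>u\<in>nbhd j W. \<exists>u'\<in>nbhd j W.
          (link (Suc j) N)\<^sup>*\<^sup>* x u \<and> (link (Suc j) N)\<^sup>*\<^sup>* u' y"
        then obtain W u u' where W: "W \<in> P j" "u \<in> nbhd j W" "u' \<in> nbhd j W"
          "(link (Suc j) N)\<^sup>*\<^sup>* x u" "(link (Suc j) N)\<^sup>*\<^sup>* u' y" by blast
        \<comment> \<open>The finer excursion since the last visit is too short to reach the
          neighbourhood of another core, so the new visit is to the same \<open>W\<close> and
          everything from \<open>u\<close> to \<open>z\<close> merges into one jump.\<close>
        have "d u' y \<le> 2 * R (Suc j)" using IH W by (auto simp: nbhd_def)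
        also have "\<dots> \<le> \<beta> / 2 * R j"
          unfolding R_Suc using r_le \<beta>_pos R_pos[of j] mult_right_mono[of "2 * r" "\<beta> / 2" "R j"] by simp
        finally have "W = W'" using nbhd_unique W W' True by blast
        then show ?thesis using W W' True by blast
      qed
    qed
  qed
  then show ?case
  proof
    assume "(link (Suc j) N)\<^sup>*\<^sup>* x y"
    then show ?thesis using IH[of x y] Suc.prems R_mono[of j "Suc j"] by simp
  next
    assume "\<exists>W\<in>P j. \<exists>u\<in>nbhd j W. \<exists>u'\<in>nbhd j W.
      (link (Suc j) N)\<^sup>*\<^sup>* x u \<and> (link (Suc j) N)\<^sup>*\<^sup>* u' y"
    then obtain W u u' where W: "W \<in> P j" "u \<in> nbhd j W" "u' \<in> nbhd j W"
      "(link (Suc j) N)\<^sup>*\<^sup>* x u" "(link (Suc j) N)\<^sup>*\<^sup>* u' y" by blast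
    have in_B: "u \<in> B" "u' \<in> B" "y \<in> B" using W link_B Suc.prems by (auto simp: nbhd_def)
    have "d x y \<le> d x u + d u u' + d u' y"
      using d_tri[of x u y] d_tri[of u u' y] in_B Suc.prems by simp
    also have "\<dots> \<le> 2 * R (Suc j) + (1 + \<beta> / 2) * R j + 2 * R (Suc j)"
      using IH W nbhd_diam[OF W(1-3)] in_B Suc.prems by (intro add_mono) auto
    also have "\<dots> = (4 * r + 1 + \<beta> / 2) * R j" by (simp add: R_Suc algebra_simps)
    \<comment> \<open>With \<open>r \<le> 1 / 16\<close> and \<open>\<beta> \<le> 1\<close> the
      bracket is at most \<open>7 / 4\<close>, so the bound reproduces itself.\<close>
    also have "\<dots> \<le> 2 * R j"
      using r_le \<beta>_le R_pos[of j] by (intro mult_right_mono) auto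
    finally show ?thesis .
  qed
qed

lemma link_mono: "(link j N)\<^sup>*\<^sup>* x y \<Longrightarrow> N \<le> N' \<Longrightarrow> j' \<le> j \<Longrightarrow> (link j' N')\<^sup>*\<^sup>* x y"
proof -
  assume "(link j N)\<^sup>*\<^sup>* x y" "N \<le> N'" "j' \<le> j"
  moreover from this have "link j N \<le> link j' N'"
    unfolding link_def by (auto intro: order_trans)
  ultimately show ?thesis using rtranclp_mono by blast
qed

text \<open>An absorption through \<open>W\<close> is a single link: by induction \<open>y\<close>
  and \<open>w\<close> lie within \<open>\<beta> / 8 * R m\<close> of the core \<open>W\<close>, and
  the absorbed point adds another \<open>\<beta> / 8 * R m\<close>, which together is the radius of
  \<open>nbhd m W\<close>.\<close>

lemma env_linked: "env k V x \<Longrightarrow> \<exists>v\<in>V. \<exists>N. (link (Suc k) N)\<^sup>*\<^sup>* v x"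
proof (induction rule: env.induct)
  case (base V k x)
  then show ?case by blast
next
  case (step k V y m W w x)
  obtain v N where v: "v \<in> V" "(link (Suc k) N)\<^sup>*\<^sup>* v y" using step.IH(1) by blast
  have near: "\<exists>w'\<in>W. d w' u \<le> \<beta> / 8 * R m" if ex: "\<exists>v\<in>W. \<exists>N. (link (Suc m) N)\<^sup>*\<^sup>* v u" for u
  proof -
    obtain w' N' where w': "w' \<in> W" "(link (Suc m) N')\<^sup>*\<^sup>* w' u" using ex by blast
    have "w' \<in> B" using w' env_core[OF step.hyps(2)] core_sub by blast
    then have "d w' u \<le> 2 * R (Suc m)" using linked_bounded_dist w' by blast
    also have "\<dots> \<le> \<beta> / 8 * R m"
      unfolding R_Suc using r_le R_pos[of m] mult_right_mono[of "2 * r" "\<beta> / 8" "R m"] by simp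
    finally show ?thesis using w' by blast
  qed
  have W: "W \<in> P m" "W \<subseteq> B" using env_core[OF step.hyps(2)] core_sub by auto
  have in_B: "y \<in> B" "w \<in> B" using env_B step.hyps by auto
  have pos: "\<beta> * R m > 0" using \<beta>_pos R_pos by simp
  have "y \<in> nbhd m W" using near[OF step.IH(2)] in_B pos by (force simp: nbhd_def)
  moreover have "x \<in> nbhd m W"
  proof -
    obtain w' where w': "w' \<in> W" "d w' w \<le> \<beta> / 8 * R m" using near[OF step.IH(3)] by blast
    have "d w' x \<le> d w' w + d w x" using d_tri w' in_B W step.hyps by blast
    then have "d w' x \<le> \<beta> / 4 * R m" using w' step.hyps by simp
    then show ?thesis using w' step.hyps by (auto simp: nbhd_def)
  qed
  ultimately have "link (Suc k) (max N m) y x"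
    using W step.hyps by (auto simp: link_def intro!: exI[of _ m] exI[of _ W])
  moreover have "(link (Suc k) (max N m))\<^sup>*\<^sup>* v y" using v link_mono by (meson max.cobounded1 order_refl)
  ultimately show ?case using v by (meson rtranclp.rtrancl_into_rtrancl)
qed

lemma env_near_core:
  assumes "env k V x"
  shows "\<exists>v\<in>V. d v x \<le> \<beta> / 8 * R k"
proof -
  obtain v N where v: "v \<in> V" "(link (Suc k) N)\<^sup>*\<^sup>* v x" using env_linked assms by blast
  have "v \<in> B" using v env_core[OF assms] core_sub by blast
  then have "d v x \<le> 2 * R (Suc k)" using linked_bounded_dist v by blast
  also have "\<dots> \<le> \<beta> / 8 * R k"
    unfolding R_Suc using r_le R_pos[of k] mult_right_mono[of "2 * r" "\<beta> / 8" "R k"] by simp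
  finally show ?thesis using v by blast
qed

lemma env_nbhd: "env k V x \<Longrightarrow> x \<in> nbhd k V"
proof -
  assume h: "env k V x"
  have "\<beta> * R k > 0" using \<beta>_pos R_pos by simp
  then show ?thesis using env_near_core[OF h] env_B[OF h] by (force simp: nbhd_def)
qed

lemma env_unique:
  assumes "env k V x" "env k W x"
  shows "V = W"
proof -
  have "\<beta> * R k > 0" using \<beta>_pos R_pos by simp
  then show ?thesis
    using nbhd_unique[OF env_core env_core env_nbhd env_nbhd, OF assms assms] env_B[OF assms(1)] by simp
qed

lemma env_diam:
  assumes "env k V x" "env k V y"
  shows "d x y \<le> 2 * R k"
proof -
  have "d x y \<le> (1 + \<beta> / 2) * R k" using nbhd_diam env_core env_nbhd assms by blast
  also have "\<dots> \<le> 2 * R k" using \<beta>_le R_pos[of k] by (intro mult_right_mono) auto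
  finally show ?thesis .
qed

lemma env_absorbs_nbhd:
  "env l V z \<Longrightarrow> env m W z \<Longrightarrow> l < m \<Longrightarrow> z' \<in> B \<Longrightarrow> d z z' < \<beta> / 8 * R m \<Longrightarrow> env l V z'"
  by (rule env.step[of _ _ z _ _ z])

lemma env_nested: "env l V z \<Longrightarrow> env m W z \<Longrightarrow> l < m \<Longrightarrow> env m W z' \<Longrightarrow> env l V z'"
  using \<beta>_pos R_pos[of m] by (auto intro!: env.step[of l V z m W z' z'] dest: env_B)

end

section \<open>Branches and their labels\<close>

lemma le_lcp_lenI: "q \<le> length xs \<Longrightarrow> q \<le> length ys \<Longrightarrow> take q xs = take q ys \<Longrightarrow> q \<le> lcp_len xs ys"
proof (induction xs ys arbitrary: q rule: lcp_len.induct)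
  case (1 x xs y ys)
  then show ?case by (cases q) auto
qed auto

lemma lcp_len_le: "lcp_len xs ys \<le> length xs" "lcp_len xs ys \<le> length ys"
  by (induction xs ys rule: lcp_len.induct) auto

lemma take_le_lcp_len: "q \<le> lcp_len xs ys \<Longrightarrow> take q xs = take q ys"
proof (induction xs ys arbitrary: q rule: lcp_len.induct)
  case (1 x xs y ys)
  then show ?case by (cases q) (auto split: if_splits)
qed auto

lemma lcp_len_commute: "lcp_len xs ys = lcp_len ys xs"
  by (induction xs ys rule: lcp_len.induct) auto

context core_family
begin

text \<open>The level is kept beside the core because one set may be a core of several levels.
  Levels without an envelope are skipped, so places in the list do not correspond to levels.\<close>

definition entries :: "'b \<Rightarrow> nat \<Rightarrow> nat \<Rightarrow> (nat \<times> 'b set) list" where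
  "entries z i t = map (\<lambda>l. (l, THE V. env l V z)) (filter (\<lambda>l. \<exists>V. env l V z) [i..<t])"

lemma the_env: "env l V z \<Longrightarrow> (THE V. env l V z) = V"
proof (rule the_equality)
  fix W assume "env l V z" "env l W z"
  then show "W = V" using env_unique[of l W z V] by simp
qed

lemma entries_append: "i \<le> j \<Longrightarrow> j \<le> t \<Longrightarrow> entries z i t = entries z i j @ entries z j t"
proof -
  assume "i \<le> j" "j \<le> t"
  then have "[i..<t] = [i..<j] @ [j..<t]" using upt_add_eq_append[of i j "t - j"] by simp
  then show ?thesis by (simp add: entries_def)
qed

lemma length_entries: "length (entries z i t) = card {l \<in> {i..<t}. \<exists>V. env l V z}"
proof -
  have "length (entries z i t) = card (set (filter (\<lambda>l. \<exists>V. env l V z) [i..<t]))"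
    unfolding entries_def length_map by (subst distinct_card) auto
  also have "set (filter (\<lambda>l. \<exists>V. env l V z) [i..<t]) = {l \<in> {i..<t}. \<exists>V. env l V z}" by auto
  finally show ?thesis .
qed

lemma length_entries_le: "length (entries z i t) \<le> t - i"
proof -
  have "card {l \<in> {i..<t}. \<exists>V. env l V z} \<le> card {i..<t}" by (intro card_mono) auto
  then show ?thesis by (simp add: length_entries)
qed

lemma set_entries: "(l, V) \<in> set (entries z i t) \<longleftrightarrow> i \<le> l \<and> l < t \<and> env l V z"
proof
  assume "(l, V) \<in> set (entries z i t)"
  then have "i \<le> l \<and> l < t \<and> (\<exists>V. env l V z)" "V = (THE V. env l V z)"
    unfolding entries_def set_map set_filter image_iff by simp_all
  then show "i \<le> l \<and> l < t \<and> env l V z" using the_env by metis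
next
  assume *: "i \<le> l \<and> l < t \<and> env l V z"
  then have "l \<in> set (filter (\<lambda>l. \<exists>V. env l V z) [i..<t])" by auto
  then have "(l, THE V. env l V z) \<in> set (entries z i t)" unfolding entries_def set_map by (rule imageI)
  moreover have "(THE V. env l V z) = V" using * by (intro the_env) simp
  ultimately show "(l, V) \<in> set (entries z i t)" by simp
qed

lemma distinct_entries: "distinct (entries z i t)"
  unfolding entries_def by (simp add: distinct_map inj_on_def)

lemma entries_cong:
  assumes "\<And>l V. i \<le> l \<Longrightarrow> l < t \<Longrightarrow> env l V z \<longleftrightarrow> env l V z'"
  shows "entries z i t = entries z' i t"
proof -
  have "filter (\<lambda>l. \<exists>V. env l V z) [i..<t] = filter (\<lambda>l. \<exists>V. env l V z') [i..<t]"
    using assms by (intro filter_cong) auto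
  then show ?thesis unfolding entries_def using assms by auto
qed

text \<open>The tree property: every coarser envelope that meets this one contains it, so an
  envelope determines all coarser entries.\<close>

lemma entries_of_env:
  assumes "env m W z" "env m W z'"
  shows "entries z 0 (Suc m) = entries z' 0 (Suc m)"
proof (rule entries_cong)
  fix l V assume "l < Suc m"
  then consider "l < m" | "l = m" by linarith
  then show "env l V z \<longleftrightarrow> env l V z'"
    using env_nested[OF _ assms(1) _ assms(2)] env_nested[OF _ assms(2) _ assms(1)] env_unique assms
    by cases blast+
qed

lemma length_entries_le_1:
  assumes "\<And>l l' V W. i \<le> l \<Longrightarrow> l < l' \<Longrightarrow> l' < t \<Longrightarrow> env l V z \<Longrightarrow> env l' W z \<Longrightarrow> False"
  shows "length (entries z i t) \<le> 1"
proof -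
  have "l = l'" if "l \<in> {l \<in> {i..<t}. \<exists>V. env l V z}" "l' \<in> {l \<in> {i..<t}. \<exists>V. env l V z}" for l l'
    using that assms by (cases l l' rule: linorder_cases) auto
  then have "card {l \<in> {i..<t}. \<exists>V. env l V z} \<le> Suc 0"
    by (subst card_le_Suc0_iff_eq) auto
  then show ?thesis by (simp add: length_entries)
qed

text \<open>Let \<open>\<mu>\<close> be the first disagreement. If \<open>z\<close> had entries at
  two levels \<open>l < l'\<close> in \<open>[\<mu>, m)\<close>, the finer one would make every
  coarser envelope of \<open>z\<close> absorb \<open>z'\<close>. The entry at \<open>l\<close> then
  contains both points and makes every still coarser envelope of \<open>z'\<close> absorb
  \<open>z\<close>, so the points would agree at \<open>\<mu>\<close> after all.\<close>

lemma entries_diverge: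
  assumes z: "z \<in> B" "z' \<in> B" and close: "m = 0 \<or> d z z' < \<beta> / 8 * R m"
  shows "\<exists>\<mu>\<le>m. entries z 0 \<mu> = entries z' 0 \<mu> \<and>
    length (entries z \<mu> m) \<le> 1 \<and> length (entries z' \<mu> m) \<le> 1"
proof (cases "\<forall>l<m. \<forall>V. env l V z \<longleftrightarrow> env l V z'")
  case True
  then have "entries z 0 m = entries z' 0 m" by (intro entries_cong) auto
  then show ?thesis by (intro exI[of _ m]) (simp add: entries_def)
next
  case False
  define \<mu> where "\<mu> = (LEAST l. l < m \<and> (\<exists>V. env l V z \<noteq> env l V z'))"
  have \<mu>: "\<mu> < m" "\<exists>V. env \<mu> V z \<noteq> env \<mu> V z'"
    using False LeastI_ex[of "\<lambda>l. l < m \<and> (\<exists>V. env l V z \<noteq> env l V z')"] by (auto simp: \<mu>_def)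
  have below: "env l V z = env l V z'" if "l < \<mu>" for l V
    using that not_less_Least[of l "\<lambda>l. l < m \<and> (\<exists>V. env l V z \<noteq> env l V z')"] \<mu>(1)
    by (auto simp: \<mu>_def)
  have aux: "length (entries x \<mu> m) \<le> 1"
    if x: "x \<in> B" "y \<in> B" "d x y < \<beta> / 8 * R m" "\<exists>V. env \<mu> V x \<noteq> env \<mu> V y" for x y
  proof (rule length_entries_le_1)
    fix l l' V W
    assume l: "\<mu> \<le> l" "l < l'" "l' < m" and VW: "env l V x" "env l' W x"
    have dist: "d x y < \<beta> / 8 * R a" "d y x < \<beta> / 8 * R a" if "a \<le> m" for a
    proof -
      have "\<beta> / 8 * R m \<le> \<beta> / 8 * R a" using \<beta>_pos R_mono[OF that] by (intro mult_left_mono) auto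
      then show "d x y < \<beta> / 8 * R a" "d y x < \<beta> / 8 * R a" using x d_sym[of x y] by auto
    qed
    have Vy: "env l V y" using env_absorbs_nbhd[OF VW l(2) x(2)] dist l by simp
    obtain V0 where V0: "env \<mu> V0 x \<noteq> env \<mu> V0 y" using x(4) by blast
    show False
    proof (cases "env \<mu> V0 x")
      case True
      then have "env \<mu> V0 y" using env_absorbs_nbhd[OF True VW(2) _ x(2)] dist l by simp
      then show False using True V0 by simp
    next
      case False
      then have V0y: "env \<mu> V0 y" using V0 by simp
      show False
      proof (cases "\<mu> = l")
        case True
        then have "V = V0" using Vy V0y env_unique by blast
        then show False using VW(1) True False by simp
      next
        case neq: False
        then show False using env_absorbs_nbhd[OF V0y Vy _ x(1)] dist l False by simp
      qed
    qed
  qed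
  have dzz: "d z z' < \<beta> / 8 * R m" using close \<mu>(1) by auto
  then have dzz': "d z' z < \<beta> / 8 * R m" using d_sym z by simp
  have "\<exists>V. env \<mu> V z' \<noteq> env \<mu> V z" using \<mu>(2) by metis
  then have "length (entries z \<mu> m) \<le> 1" "length (entries z' \<mu> m) \<le> 1"
    using aux[OF z dzz \<mu>(2)] aux[OF z(2,1) dzz'] by auto
  moreover have "entries z 0 \<mu> = entries z' 0 \<mu>" using below by (intro entries_cong) auto
  ultimately show ?thesis using \<mu>(1) by (intro exI[of _ \<mu>]) simp
qed

lemma length_entries_close:
  assumes "z \<in> B" "z' \<in> B" "m = 0 \<or> d z z' < \<beta> / 8 * R m"
  shows "length (entries z 0 m) \<le> length (entries z' 0 m) + 1"
proof -
  obtain \<mu> where "\<mu> \<le> m" "entries z 0 \<mu> = entries z' 0 \<mu>" "length (entries z \<mu> m) \<le> 1"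
    using entries_diverge[OF assms] by blast
  then show ?thesis using entries_append[of 0 \<mu> m z] entries_append[of 0 \<mu> m z'] by simp
qed

text \<open>Valid for every labelling: the branches coincide up to \<open>\<mu>\<close>, and past it
  each has at most one entry before \<open>m\<close> and one per level from there on.\<close>

lemma word_dist_upper:
  fixes lab :: "nat \<times> 'b set \<Rightarrow> nat"
  assumes z: "z \<in> B" "z' \<in> B" "m = 0 \<or> d z z' < \<beta> / 8 * R m" and t: "m \<le> t" "m \<le> t'"
  shows "length (entries z 0 t) + length (entries z' 0 t') \<le>
    2 * lcp_len (map lab (entries z 0 t)) (map lab (entries z' 0 t')) + (t - m) + (t' - m) + 2"
proof -
  obtain \<mu> where \<mu>: "\<mu> \<le> m" "entries z 0 \<mu> = entries z' 0 \<mu>"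
    "length (entries z \<mu> m) \<le> 1" "length (entries z' \<mu> m) \<le> 1"
    using entries_diverge[OF z] by blast
  have split: "entries x 0 s = entries x 0 \<mu> @ entries x \<mu> m @ entries x m s" if "m \<le> s" for x s
    using entries_append[of 0 m s x] entries_append[of 0 \<mu> m x] that \<mu>(1) by simp
  have "length (entries z 0 \<mu>) \<le> lcp_len (map lab (entries z 0 t)) (map lab (entries z' 0 t'))"
    by (rule le_lcp_lenI) (use split[OF t(1), of z] split[OF t(2), of z'] \<mu>(2) in simp_all)
  then show ?thesis
    using split[OF t(1), of z] split[OF t(2), of z'] \<mu> length_entries_le[of z m t] length_entries_le[of z' m t']
    by simp
qed

text \<open>A conflict consists of the last \<open>j\<close> entries of two diverging branches whose labels should not all
  coincide. Only branches that stay within distance and level ranges controlled by \<open>L * j\<close> are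
  listed, so that the doubling condition bounds their number exponentially in \<open>j\<close>.\<close>

definition pt :: "'b set \<Rightarrow> 'b" where
  "pt W = (SOME w. w \<in> W)"

definition anc :: "nat \<times> 'b set \<Rightarrow> (nat \<times> 'b set) list" where
  "anc u = entries (pt (snd u)) 0 (Suc (fst u))"

definition tail :: "nat \<Rightarrow> nat \<times> 'b set \<Rightarrow> (nat \<times> 'b set) list" where
  "tail j u = drop (length (anc u) - j) (anc u)"

text \<open>The distance bound reads \<open>d y x \<le> K * R (fst v - q)\<close>, written so that
  it makes sense also when \<open>q\<close> exceeds the level.\<close>

definition near :: "nat \<Rightarrow> real \<Rightarrow> nat \<times> 'b set \<Rightarrow> nat \<times> 'b set \<Rightarrow> bool" where
  "near q K u v \<longleftrightarrow> fst u \<le> fst v + q \<and> fst v \<le> fst u + q \<and>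
    (\<forall>x\<in>snd u. \<forall>y\<in>snd v. d y x * r ^ q \<le> K * R (fst v))"

definition conflicts :: "nat \<Rightarrow> real \<Rightarrow> ((nat \<times> 'b set) \<times> (nat \<times> 'b set) \<times> nat) set" where
  "conflicts L K = {(u, u', j). 1 \<le> j \<and> snd u \<in> P (fst u) \<and> snd u' \<in> P (fst u') \<and>
     j \<le> length (anc u) \<and> j \<le> length (anc u') \<and> distinct (tail j u @ tail j u') \<and>
     (\<forall>v\<in>set (tail j u @ tail j u'). near (L * j) K u v \<and> near (L * j) K u' v)}"

section \<open>Counting the conflicts through a vertex\<close>

lemma pt_in: "W \<in> P m \<Longrightarrow> pt W \<in> W"
  using core_ne[of W m] by (simp add: pt_def some_in_eq)

lemma anc_eq: "env m W z \<Longrightarrow> anc (m, W) = entries z 0 (Suc m)"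
  using entries_of_env[OF env.base[OF env_core pt_in[OF env_core]]] by (simp add: anc_def)

text \<open>An entry determines the branch up to its own place. This is why a conflict can be stored
  as two end vertices and a length.\<close>

lemma anc_nth:
  assumes "q < length (entries z 0 t)"
  shows "anc (entries z 0 t ! q) = take (Suc q) (entries z 0 t)"
proof -
  obtain m W where mW: "entries z 0 t ! q = (m, W)" by fastforce
  then have "(m, W) \<in> set (entries z 0 t)" using assms nth_mem by metis
  then have m: "m < t" "env m W z" by (auto simp: set_entries)
  have one: "entries z m (Suc m) = [(m, W)]" using m by (auto simp: entries_def the_env)
  have "entries z 0 t = entries z 0 m @ (m, W) # entries z (Suc m) t"
    using entries_append[of 0 m t z] entries_append[of m "Suc m" t z] m one by simp
  then have eq: "entries z 0 t ! length (entries z 0 m) = (m, W)"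
      "take (Suc (length (entries z 0 m))) (entries z 0 t) = entries z 0 m @ [(m, W)]"
      "length (entries z 0 m) < length (entries z 0 t)" by auto
  then have "q = length (entries z 0 m)"
    using distinct_entries[of z 0 t] mW assms nth_eq_iff_index_eq by metis
  then show ?thesis
    using eq mW anc_eq[OF m(2)] entries_append[of 0 m "Suc m" z] one by simp
qed

lemma tail_nth:
  assumes "i + j \<le> length (entries z 0 t)" "1 \<le> j"
  shows "tail j (entries z 0 t ! (i + j - 1)) = take j (drop i (entries z 0 t))"
proof -
  have "anc (entries z 0 t ! (i + j - 1)) = take (i + j) (entries z 0 t)"
    using anc_nth[of "i + j - 1" z t] assms by simp
  then show ?thesis using assms by (simp add: tail_def drop_take)
qed

lemma set_tail_core: "v \<in> set (tail j u) \<Longrightarrow> snd v \<in> P (fst v)"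
proof -
  assume "v \<in> set (tail j u)"
  then have "(fst v, snd v) \<in> set (anc u)" unfolding tail_def by (simp add: in_set_dropD)
  then show ?thesis unfolding anc_def set_entries using env_core by blast
qed

text \<open>At each of at most \<open>2 * q + 1\<close> levels the near cores have representatives
  in one ball, and these are separated by at least \<open>\<beta> * R (l + q)\<close>. One factor
  \<open>r ^ q\<close> in the condition on \<open>i\<close> comes from the radius of the ball, the
  other from the finest level.\<close>

lemma card_near:
  assumes C: "\<forall>c\<in>B. \<forall>\<rho>>0. \<exists>S\<subseteq>B. finite S \<and> real (card S) \<le> real C \<and>
       mball B d c \<rho> \<subseteq> (\<Union>s\<in>S. mball B d s (\<rho>/2))"
    and K: "K > 0" and V: "V \<in> P l"
    and i: "4 * K / \<beta> \<le> 2 ^ i * r ^ q * r ^ q"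
  shows "finite {u. snd u \<in> P (fst u) \<and> near q K u (l, V)} \<and>
    card {u. snd u \<in> P (fst u) \<and> near q K u (l, V)} \<le> (2 * q + 1) * C ^ i"
proof -
  define fam where "fam m = {W \<in> P m. near q K (m, W) (l, V)}" for m
  have fam: "finite (fam m) \<and> card (fam m) \<le> C ^ i" if m: "m \<le> l + q" for m
  proof -
    \<comment> \<open>The factor \<open>2\<close> turns the non-strict bound of \<open>near\<close>
      into membership in an open ball.\<close>
    define \<rho> where "\<rho> = 2 * (K * R l / r ^ q)"
    have pos: "K * R l / r ^ q > 0" using K R_pos r_pos by simp
    have inj: "inj_on pt (fam m)"
    proof (rule inj_onI, rule ccontr)
      fix W W' assume W: "W \<in> fam m" "W' \<in> fam m" "pt W = pt W'" "W \<noteq> W'"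
      then have "W \<in> P m" "W' \<in> P m" by (auto simp: fam_def)
      then have "\<beta> * R m < d (pt W) (pt W')" "pt W \<in> B"
        using core_sep[OF _ _ W(4)] pt_in core_sub by blast+
      moreover have "\<beta> * R m > 0" using \<beta>_pos R_pos by simp
      ultimately show False using W(3) by simp
    qed
    have "finite (pt ` fam m) \<and> card (pt ` fam m) \<le> C ^ i"
    proof (rule card_separated[OF C])
      show "pt V \<in> B" using V pt_in core_sub by blast
      show "\<rho> > 0" using pos by (simp add: \<rho>_def)
      show "pt ` fam m \<subseteq> mball B d (pt V) \<rho>"
      proof clarify
        fix W assume "W \<in> fam m"
        then have W: "W \<in> P m" "near q K (m, W) (l, V)" by (auto simp: fam_def)
        have "pt W \<in> W" "pt V \<in> V" using W V pt_in by auto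
        then have "d (pt V) (pt W) * r ^ q \<le> K * R l" using W(2) by (auto simp: near_def)
        then have "d (pt V) (pt W) \<le> K * R l / r ^ q" using r_pos by (simp add: field_simps)
        moreover have "pt W \<in> B" using W pt_in core_sub by blast
        ultimately show "pt W \<in> mball B d (pt V) \<rho>" using pos by (simp add: mball_def \<rho>_def)
      qed
      fix x y assume xy: "x \<in> pt ` fam m" "y \<in> pt ` fam m" "x \<noteq> y"
      then obtain W W' where W: "W \<in> P m" "W' \<in> P m" "x = pt W" "y = pt W'" "W \<noteq> W'"
        by (auto simp: fam_def)
      have "2 * \<rho> / 2 ^ i = 4 * K * R l / (2 ^ i * r ^ q)" by (simp add: \<rho>_def field_simps)
      also have "\<dots> = (4 * K / \<beta>) * (\<beta> * R l / (2 ^ i * r ^ q))" using \<beta>_pos by simp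
      also have "\<dots> \<le> (2 ^ i * r ^ q * r ^ q) * (\<beta> * R l / (2 ^ i * r ^ q))"
        using i \<beta>_pos R_pos[of l] r_pos by (intro mult_right_mono) auto
      also have "\<dots> = \<beta> * (R l * r ^ q)" using r_pos by simp
      also have "R l * r ^ q = R (l + q)" by (simp add: R_def power_add)
      also have "\<beta> * R (l + q) \<le> \<beta> * R m" using R_mono[OF m] \<beta>_pos by simp
      also have "\<dots> \<le> d x y" using core_sep[OF W(1,2,5)] pt_in W by (metis less_imp_le)
      finally show "2 * \<rho> / 2 ^ i \<le> d x y" .
    qed
    then show ?thesis using inj finite_image_iff card_image by metis
  qed
  have sub: "{u. snd u \<in> P (fst u) \<and> near q K u (l, V)} \<subseteq> (\<Union>m\<in>{l - q..l + q}. Pair m ` fam m)"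
    by (force simp: fam_def near_def)
  have fin: "finite (\<Union>m\<in>{l - q..l + q}. Pair m ` fam m)" using fam by auto
  have "card (\<Union>m\<in>{l - q..l + q}. Pair m ` fam m) \<le> (\<Sum>m\<in>{l - q..l + q}. card (Pair m ` fam m))"
    by (rule card_UN_le) simp
  also have "\<dots> \<le> (\<Sum>m\<in>{l - q..l + q}. C ^ i)"
    using fam by (intro sum_mono) (auto intro: order_trans[OF card_image_le])
  also have "\<dots> = (l + q + 1 - (l - q)) * C ^ i" by simp
  also have "\<dots> \<le> (2 * q + 1) * C ^ i" by (intro mult_right_mono) auto
  finally show ?thesis using finite_subset[OF sub fin] card_mono[OF fin sub] by linarith
qed

lemma exists_conflict_free_labelling:
  assumes dbl: "doubling B d" and K: "K \<ge> 1"
  shows "\<exists>N\<ge>1. \<exists>lab :: nat \<times> 'b set \<Rightarrow> nat. (\<forall>v. lab v < N) \<and>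
    (\<forall>(u, u', j)\<in>conflicts L K. map lab (tail j u) \<noteq> map lab (tail j u'))"
proof -
  obtain C0 :: real where C0: "\<forall>c\<in>B. \<forall>\<rho>>0. \<exists>S\<subseteq>B. finite S \<and> real (card S) \<le> C0 \<and>
       mball B d c \<rho> \<subseteq> (\<Union>s\<in>S. mball B d s (\<rho>/2))"
    using dbl unfolding doubling_def by blast
  define C where "C = Suc (nat \<lceil>C0\<rceil>)"
  have "C0 \<le> real C" unfolding C_def by linarith
  then have C: "\<forall>c\<in>B. \<forall>\<rho>>0. \<exists>S\<subseteq>B. finite S \<and> real (card S) \<le> real C \<and>
       mball B d c \<rho> \<subseteq> (\<Union>s\<in>S. mball B d s (\<rho>/2))"
    using C0 by (meson order_trans)
  \<comment> \<open>Chosen to fit \<open>j = 1\<close>; since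
    \<open>4 * K / \<beta> \<ge> 1\<close>, taking \<open>j\<close>-th powers makes
    \<open>E * j\<close> fit every length \<open>j\<close>.\<close>
  obtain E :: nat where E: "(4 * K / \<beta>) / (r ^ L * r ^ L) \<le> 2 ^ E"
    using real_arch_pow[of 2 "(4 * K / \<beta>) / (r ^ L * r ^ L)"] by (auto intro: less_imp_le)
  have K\<beta>: "4 * K / \<beta> \<ge> 1" using K \<beta>_le \<beta>_pos by (simp add: field_simps)
  have E_j: "4 * K / \<beta> \<le> 2 ^ (E * j) * r ^ (L * j) * r ^ (L * j)" if "1 \<le> j" for j
  proof -
    have "4 * K / \<beta> \<le> (4 * K / \<beta>) ^ j" using K\<beta> that by (simp add: self_le_power)
    also have "\<dots> \<le> (2 ^ E * (r ^ L * r ^ L)) ^ j"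
    proof (rule power_mono)
      show "4 * K / \<beta> \<le> 2 ^ E * (r ^ L * r ^ L)"
        using E r_pos by (subst (asm) pos_divide_le_eq) auto
    qed (use K\<beta> in simp)
    also have "\<dots> = 2 ^ (E * j) * r ^ (L * j) * r ^ (L * j)"
      by (simp add: power_mult_distrib power_mult)
    finally show ?thesis .
  qed
  \<comment> \<open>\<open>N0 ^ j\<close> bounds the candidates for one end of a conflict of length
    \<open>j\<close>, the number of levels being made exponential by Bernoulli's inequality; the
    square accounts for the two ends.\<close>
  define N0 where "N0 = (2 * L + 1) * C ^ E"
  define N where "N = N0\<^sup>2"
  have "N0 > 0" by (simp add: N0_def C_def)
  then have N: "N \<ge> 1" by (simp add: N_def Suc_le_eq)
  have bern: "(2 * (L * j) + 1) * C ^ (E * j) \<le> N0 ^ j" for j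
  proof -
    have "2 * (L * j) + 1 \<le> (2 * L + 1) ^ j"
    proof (induction j)
      case (Suc j)
      have "2 * (L * Suc j) + 1 \<le> (2 * L + 1) * (2 * (L * j) + 1)" by (simp add: algebra_simps)
      also have "\<dots> \<le> (2 * L + 1) * (2 * L + 1) ^ j" using Suc by (rule mult_left_mono) simp
      finally show ?case by simp
    qed simp
    then have "(2 * (L * j) + 1) * (C ^ E) ^ j \<le> (2 * L + 1) ^ j * (C ^ E) ^ j"
      by (rule mult_right_mono) simp
    then show ?thesis unfolding N0_def power_mult_distrib power_mult .
  qed
  let ?I = "conflicts L K"
  let ?xs = "\<lambda>i. tail (snd (snd i)) (fst i)" and ?ys = "\<lambda>i. tail (snd (snd i)) (fst (snd i))"
  have len: "length (?xs i) = snd (snd i)" "length (?ys i) = snd (snd i)" "1 \<le> snd (snd i)" if "i \<in> ?I" for i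
    using that unfolding conflicts_def tail_def by auto
  have "\<exists>f :: nat \<times> 'b set \<Rightarrow> nat. (\<forall>v. f v < 4 * N) \<and> (\<forall>i\<in>?I. map f (?xs i) \<noteq> map f (?ys i))"
  proof (rule exists_labelling[OF N])
    fix i assume i: "i \<in> ?I"
    have "distinct (?xs i @ ?ys i)" using i unfolding conflicts_def by auto
    moreover have "?xs i \<noteq> []" using len[OF i] by force
    ultimately show "length (?xs i) = length (?ys i) \<and> ?xs i \<noteq> [] \<and> distinct (?xs i @ ?ys i)"
      using len[OF i] by simp
  next
    fix v j
    let ?S = "{i \<in> ?I. v \<in> set (?xs i @ ?ys i) \<and> length (?xs i) = j}"
    define Cand where "Cand = {u. snd u \<in> P (fst u) \<and> near (L * j) K u v}"
    have sub: "?S \<subseteq> Cand \<times> Cand \<times> {j}"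
    proof
      fix i assume "i \<in> ?S"
      then have i: "i \<in> ?I" "v \<in> set (?xs i @ ?ys i)" "snd (snd i) = j" using len(1)[of i] by simp_all
      obtain u u' where u: "i = (u, u', j)" using i(3) by (cases i) auto
      have "u \<in> Cand" "u' \<in> Cand" using i(1,2) unfolding u conflicts_def Cand_def by auto
      then show "i \<in> Cand \<times> Cand \<times> {j}" using u by simp
    qed
    show "finite ?S \<and> card ?S \<le> N ^ j"
    proof (cases "\<exists>i. i \<in> ?S")
      case False
      then have "?S = {}" by blast
      then show ?thesis by (simp only: finite.emptyI card.empty) simp
    next
      case True
      then obtain i where "i \<in> ?S" ..
      then have i: "i \<in> ?I" "v \<in> set (?xs i @ ?ys i)" "snd (snd i) = j" using len(1)[of i] by simp_all
      have j: "1 \<le> j" using len(3)[OF i(1)] i(3) by simp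
      have v: "snd v \<in> P (fst v)" using i(2) set_tail_core unfolding set_append by blast
      have K0: "K > 0" using K by simp
      have "finite Cand \<and> card Cand \<le> (2 * (L * j) + 1) * C ^ (E * j)"
        using card_near[OF C K0 v E_j[OF j]] unfolding Cand_def by simp
      then have fin: "finite Cand" and card: "card Cand \<le> N0 ^ j" using bern le_trans by blast+
      have fin3: "finite (Cand \<times> Cand \<times> {j})" using fin by simp
      have "card ?S \<le> card (Cand \<times> Cand \<times> {j})" using fin3 sub by (rule card_mono)
      also have "\<dots> = card Cand * card Cand" by (simp add: card_cartesian_product)
      also have "\<dots> \<le> N0 ^ j * N0 ^ j" using card by (intro mult_mono) auto
      also have "\<dots> = N ^ j" by (simp add: N_def power2_eq_square power_mult_distrib)
      finally show ?thesis using finite_subset[OF sub fin3] by simp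
    qed
  qed
  then obtain lab :: "nat \<times> 'b set \<Rightarrow> nat" where
    lab: "\<forall>v. lab v < 4 * N" "\<forall>i\<in>?I. map lab (?xs i) \<noteq> map lab (?ys i)" by blast
  have "\<forall>(u, u', j)\<in>?I. map lab (tail j u) \<noteq> map lab (tail j u')" using lab(2) by fastforce
  then show ?thesis using lab(1) N by (intro exI[of _ "4 * N"] conjI exI[of _ lab]) auto
qed

text \<open>At level \<open>k\<close> the points are still close, and from \<open>\<kappa>\<close>
  on no envelope contains both. If the words agreed any further, the two windows of \<open>j\<close>
  entries ending at \<open>u\<close> and \<open>u'\<close> would form a conflict with equal
  labels.\<close>

lemma word_dist_lower:
  assumes lab: "\<forall>(u, u', j)\<in>conflicts L K. map lab (tail j u) \<noteq> map lab (tail j u')"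
    and K: "K \<ge> 4 + D" and D: "D \<ge> 0"
    and z: "z \<in> B" "z' \<in> B"
    and k: "k = 0 \<or> d z z' < \<beta> / 8 * R k" "d z z' \<le> D * R k"
    and \<kappa>: "k \<le> \<kappa>" "2 * R \<kappa> < d z z'"
    and t: "k \<le> t" "t \<le> t'" "\<kappa> \<le> t'"
    and j: "1 \<le> j" "j + 1 \<le> length (entries z' \<kappa> t')" "t' \<le> k + L * j"
  shows "lcp_len (map lab (entries z 0 t)) (map lab (entries z' 0 t')) \<le> length (entries z' 0 \<kappa>) + j"
proof (rule ccontr)
  define X where "X = entries z' 0 t'"
  define Y where "Y = entries z 0 t"
  \<comment> \<open>The branch of \<open>z\<close> may be one entry ahead at level \<open>k\<close>.
    Skipping one entry makes its window, too, start at level \<open>k\<close> or later.\<close>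
  define i where "i = length (entries z' 0 \<kappa>) + 1"
  assume "\<not> ?thesis"
  then have lcp: "i + j \<le> lcp_len (map lab Y) (map lab X)" by (simp add: i_def X_def Y_def)
  then have len: "i + j \<le> length X" "i + j \<le> length Y"
    using lcp_len_le[of "map lab Y" "map lab X"] by auto
  have take_eq: "take (i + j) (map lab Y) = take (i + j) (map lab X)" by (rule take_le_lcp_len[OF lcp])
  define u where "u = X ! (i + j - 1)"
  define u' where "u' = Y ! (i + j - 1)"
  have tails: "tail j u = take j (drop i X)" "tail j u' = take j (drop i Y)"
    using tail_nth len j(1) unfolding u_def u'_def X_def Y_def by blast+
  have X: "set (tail j u) \<subseteq> set (entries z' \<kappa> t')"
  proof -
    have "drop i X = drop 1 (entries z' \<kappa> t')"
      unfolding X_def i_def using entries_append[of 0 \<kappa> t' z'] t by simp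
    then show ?thesis unfolding tails(1)
      using set_take_subset[of j "drop i X"] set_drop_subset[of 1 "entries z' \<kappa> t'"] by simp
  qed
  have Y: "set (tail j u') \<subseteq> set (entries z k t)"
  proof -
    have "length (entries z 0 k) \<le> length (entries z' 0 k) + 1" by (rule length_entries_close[OF z k(1)])
    also have "\<dots> \<le> i" unfolding i_def using entries_append[of 0 k \<kappa> z'] \<kappa> by simp
    finally have "set (drop i Y) \<subseteq> set (drop (length (entries z 0 k)) Y)"
      by (rule set_drop_subset_set_drop)
    also have "drop (length (entries z 0 k)) Y = entries z k t"
      unfolding Y_def using entries_append[of 0 k t z] t by simp
    finally show ?thesis unfolding tails using set_take_subset by (rule subset_trans[rotated])
  qed
  have lev: "k \<le> fst v \<and> fst v < t' \<and> snd v \<in> P (fst v) \<and> (env (fst v) (snd v) z \<or> env (fst v) (snd v) z')"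
    if "v \<in> set (tail j u @ tail j u')" for v
  proof (cases "v \<in> set (tail j u)")
    case True
    then have "(fst v, snd v) \<in> set (entries z' \<kappa> t')" using X by auto
    then show ?thesis using \<kappa> env_core unfolding set_entries by fastforce
  next
    case False
    then have "(fst v, snd v) \<in> set (entries z k t)" using that Y by auto
    then show ?thesis using t env_core unfolding set_entries by fastforce
  qed
  \<comment> \<open>Every listed core lies within \<open>2 * R k\<close> of \<open>z\<close> or
    \<open>z'\<close>, and these two are at most \<open>D * R k\<close> apart; hence
    \<open>K \<ge> 4 + D\<close>.\<close>
  have dist: "d y x \<le> K * R k"
    if vw: "v \<in> set (tail j u @ tail j u')" "w \<in> set (tail j u @ tail j u')" "x \<in> snd v" "y \<in> snd w" for v w x y
  proof -
    have one: "\<exists>p\<in>{z, z'}. d x p \<le> 2 * R k \<and> x \<in> B" if v: "v \<in> set (tail j u @ tail j u')" "x \<in> snd v" for v x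
    proof -
      have ex: "env (fst v) (snd v) x" using lev[OF v(1)] v(2) env.base by blast
      obtain p where p: "p \<in> {z, z'}" "env (fst v) (snd v) p" using lev[OF v(1)] by blast
      have "d x p \<le> 2 * R (fst v)" using env_diam[OF ex p(2)] .
      also have "\<dots> \<le> 2 * R k" using R_mono lev[OF v(1)] by simp
      finally show ?thesis using p env_B[OF ex] by blast
    qed
    obtain p where p: "p \<in> {z, z'}" "d x p \<le> 2 * R k" "x \<in> B" using one[OF vw(1,3)] by blast
    obtain p' where p': "p' \<in> {z, z'}" "d y p' \<le> 2 * R k" "y \<in> B" using one[OF vw(2,4)] by blast
    have pB: "p \<in> B" "p' \<in> B" using p p' z by auto
    have "d p' p \<le> D * R k"
      using p(1) p'(1) k(2) z d_sym[of z z'] D R_pos[of k] by (auto simp: zero_le_mult_iff)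
    moreover have "d y x \<le> d y p' + d p' p + d x p"
      using d_tri[of y p' x] d_tri[of p' p x] d_sym[of p x] p p' pB by simp
    ultimately have "d y x \<le> (4 + D) * R k" using p p' by (simp add: algebra_simps)
    also have "\<dots> \<le> K * R k" using K R_pos[of k] by simp
    finally show ?thesis .
  qed
  have near: "near (L * j) K v w"
    if "v \<in> set (tail j u @ tail j u')" "w \<in> set (tail j u @ tail j u')" for v w
    unfolding near_def
  proof (intro conjI ballI)
    show "fst v \<le> fst w + L * j" "fst w \<le> fst v + L * j" using lev[OF that(1)] lev[OF that(2)] j by auto
    fix x y assume "x \<in> snd v" "y \<in> snd w"
    then have "d y x * r ^ (L * j) \<le> K * R k * r ^ (L * j)"
      using dist[OF that] r_pos by (intro mult_right_mono) auto
    also have "\<dots> = K * R (k + L * j)" by (simp add: R_def power_add)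
    also have "\<dots> \<le> K * R (fst w)"
      using K D lev[OF that(2)] j by (intro mult_left_mono R_mono) auto
    finally show "d y x * r ^ (L * j) \<le> K * R (fst w)" .
  qed
  \<comment> \<open>A common vertex would be an envelope of level at least \<open>\<kappa>\<close>
    around both points, too small for their distance.\<close>
  have disj: "v \<notin> set (tail j u')" if "v \<in> set (tail j u)" for v
  proof
    assume "v \<in> set (tail j u')"
    then have "(fst v, snd v) \<in> set (entries z k t)" "(fst v, snd v) \<in> set (entries z' \<kappa> t')"
      using X Y that by auto
    then have "env (fst v) (snd v) z" "env (fst v) (snd v) z'" "\<kappa> \<le> fst v"
      unfolding set_entries by auto
    then have "d z z' \<le> 2 * R \<kappa>" using env_diam R_mono by (metis mult_le_cancel_left_pos order_trans zero_less_numeral)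
    then show False using \<kappa> by simp
  qed
  have "distinct (tail j u)" "distinct (tail j u')"
    unfolding tails X_def Y_def using distinct_entries by (auto intro: distinct_take distinct_drop)
  then have dis: "distinct (tail j u @ tail j u')" using disj by auto
  have nth_in: "zs ! (i + j - 1) \<in> set (take j (drop i zs))"
    if "i + j \<le> length zs" for zs :: "(nat \<times> 'b set) list"
    unfolding in_set_conv_nth using that j(1) by (intro exI[of _ "j - 1"]) auto
  have last: "u \<in> set (tail j u)" "u' \<in> set (tail j u')"
    using nth_in len unfolding tails by (simp_all add: u_def u'_def)
  have "anc u = take (i + j) X" "anc u' = take (i + j) Y"
    using anc_nth[of "i + j - 1"] len j(1) unfolding u_def u'_def X_def Y_def by auto
  then have "j \<le> length (anc u)" "j \<le> length (anc u')" using len by auto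
  then have "(u, u', j) \<in> conflicts L K"
    unfolding conflicts_def using j(1) dis near last lev by auto
  then have "map lab (tail j u) \<noteq> map lab (tail j u')" using lab by auto
  moreover have "map lab (tail j u) = take j (drop i (map lab X))" "map lab (tail j u') = take j (drop i (map lab Y))"
    unfolding tails by (simp_all add: take_map drop_map)
  moreover have "take j (drop i (map lab X)) = take j (drop i (map lab Y))"
    using take_eq by (metis add.commute take_drop)
  ultimately show False by simp
qed

end

section \<open>Projection of a visual space to its boundary\<close>

lemma gromov_le_dist: "gromov b x y \<le> dist b x" "gromov b x y \<le> dist b y"
proof -
  show "gromov b x y \<le> dist b x"
    unfolding gromov_def using dist_triangle[of b y x] by (simp add: dist_commute)
  show "gromov b x y \<le> dist b y"
    unfolding gromov_def using dist_triangle[of b x y] by (simp add: dist_commute)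
qed

lemma gromov_nonneg: "0 \<le> gromov b x y"
  unfolding gromov_def using dist_triangle[of x y b] by (simp add: dist_commute)

lemma gromov_commute: "gromov b x y = gromov b y x"
  unfolding gromov_def by (simp add: dist_commute)

lemma gromov_base_change: "gromov b' x y \<le> gromov b x y + dist b b'"
proof -
  have "dist b' x \<le> dist b b' + dist b x" "dist b' y \<le> dist b b' + dist b y"
    using dist_triangle[of b' x b] dist_triangle[of b' y b] by (simp_all add: dist_commute)
  then show ?thesis unfolding gromov_def by argo
qed

lemma gromov_min2:
  fixes b x y u v :: "'a::metric_space"
  assumes "delta_hyperbolic TYPE('a) \<delta>"
  shows "min (min (gromov b x u) (gromov b u v)) (gromov b v y) - 2 * \<delta> \<le> gromov b x y"
proof -
  have hyp: "min (gromov b p q) (gromov b q s) - \<delta> \<le> gromov b p s" for p q s :: 'a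
    using assms unfolding delta_hyperbolic_def delta_triple_def by blast
  \<comment> \<open>The instance at \<open>x x x\<close> yields
    \<open>\<delta> \<ge> 0\<close>.\<close>
  show ?thesis using hyp[of x u v] hyp[of x v y] hyp[of x x x] by linarith
qed

lemma boundary_nonempty: "\<xi> \<in> boundary TYPE('a::metric_space) \<Longrightarrow> \<exists>u. u \<in> \<xi>"
proof -
  assume "\<xi> \<in> boundary TYPE('a)"
  then obtain x :: "nat \<Rightarrow> 'a" where x: "conv_inf x" "\<xi> = {y. conv_inf y \<and> seq_equiv x y}"
    unfolding boundary_def by blast
  have "seq_equiv x x" using x(1) unfolding conv_inf_def seq_equiv_def by blast
  then show ?thesis using x by blast
qed

text \<open>The space and the metric may be visual from different base points; the change costs
  \<open>2 * dist b b'\<close>, and passing from the limit inferior to almost all indices costs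
  \<open>1\<close>.\<close>

lemma visual_eventually:
  fixes b b' x :: "'a::metric_space"
  assumes "ereal (dist b x) \<le> gromov_pt_bdry b x \<xi> + ereal D" "u \<in> \<xi>"
  shows "eventually (\<lambda>i. dist b' x - (D + 1 + 2 * dist b b') \<le> gromov b' x (u i)) sequentially"
proof -
  have "ereal (dist b x) \<le> gromov_pt_bdry b x \<xi> + ereal D" by (rule assms(1))
  also have "gromov_pt_bdry b x \<xi> \<le> liminf (\<lambda>i. ereal (gromov b x (u i)))"
    unfolding gromov_pt_bdry_def using assms(2) by (rule INF_lower)
  finally have "ereal (dist b x) \<le> liminf (\<lambda>i. ereal (gromov b x (u i))) + ereal D"
    by (simp add: add_right_mono)
  then have "ereal (dist b x - D) \<le> liminf (\<lambda>i. ereal (gromov b x (u i)))"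
    by (simp add: ereal_minus_le flip: ereal_minus)
  moreover have "ereal (dist b x - D - 1) < ereal (dist b x - D)" by simp
  ultimately have "ereal (dist b x - D - 1) < liminf (\<lambda>i. ereal (gromov b x (u i)))"
    by (rule less_le_trans[rotated])
  then have "eventually (\<lambda>i. ereal (dist b x - D - 1) < ereal (gromov b x (u i))) sequentially"
    by (rule less_LiminfD)
  then show ?thesis
  proof (rule eventually_mono)
    fix i assume "ereal (dist b x - D - 1) < ereal (gromov b x (u i))"
    then have "dist b x - D - 1 < gromov b x (u i)" by simp
    moreover have "gromov b x (u i) \<le> gromov b' x (u i) + dist b b'"
      using gromov_base_change[of b x "u i" b'] by (simp add: dist_commute)
    moreover have "dist b' x \<le> dist b b' + dist b x" using dist_triangle[of b' x b] by (simp add: dist_commute)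
    ultimately show "dist b' x - (D + 1 + 2 * dist b b') \<le> gromov b' x (u i)" by linarith
  qed
qed

lemma apow_le: "1 < a \<Longrightarrow> ereal q \<le> p \<Longrightarrow> apow a p \<le> a powr - q"
  by (cases p) (auto simp: apow_def)

text \<open>\<open>\<pi> x\<close> is a boundary point in whose direction \<open>x\<close> lies. The
  two estimates come from \<open>gromov_min2\<close> along \<open>u i, x, y, v i\<close> and along
  \<open>x, u i, v i, y\<close>. The second needs a threshold \<open>G\<close> below both heights,
  because boundary points do not see how far out \<open>x\<close> and \<open>y\<close> are and may
  even coincide.\<close>

lemma boundary_projection:
  fixes d :: "(nat \<Rightarrow> 'a::metric_space) set \<Rightarrow> (nat \<Rightarrow> 'a) set \<Rightarrow> real"
  assumes hyp: "hyperbolic TYPE('a)" and vs: "visual_space TYPE('a)" and vm: "visual_metric TYPE('a) d"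
  shows "\<exists>(\<pi> :: 'a \<Rightarrow> (nat \<Rightarrow> 'a) set) b a C. a > 1 \<and> C > 0 \<and> (\<forall>x. \<pi> x \<in> boundary TYPE('a)) \<and>
    (\<forall>\<xi>\<in>boundary TYPE('a). \<forall>\<eta>\<in>boundary TYPE('a). d \<xi> \<eta> \<le> C) \<and>
    (\<forall>x y. d (\<pi> x) (\<pi> y) \<le> C * a powr (- gromov b x y)) \<and>
    (\<forall>x y G. G \<le> dist b x \<longrightarrow> G \<le> dist b y \<longrightarrow> d (\<pi> x) (\<pi> y) \<le> a powr (- G) \<longrightarrow> G \<le> gromov b x y + C)"
proof -
  obtain \<delta> where \<delta>: "\<delta> \<ge> 0" "delta_hyperbolic TYPE('a) \<delta>" using hyp unfolding hyperbolic_def by blast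
  obtain b0 :: 'a and D where D: "D > 0" "\<forall>y. \<exists>\<xi>\<in>boundary TYPE('a). ereal (dist b0 y) \<le> gromov_pt_bdry b0 y \<xi> + ereal D"
    using vs unfolding visual_space_def by blast
  obtain b :: 'a and a c1 c2 where a: "a > 1" "c1 > 0" "c2 > 0" and
    vis: "\<forall>\<xi>\<in>boundary TYPE('a). \<forall>\<eta>\<in>boundary TYPE('a).
           c1 * apow a (gromov_bdry b \<xi> \<eta>) \<le> d \<xi> \<eta> \<and> d \<xi> \<eta> \<le> c2 * apow a (gromov_bdry b \<xi> \<eta>)"
    using vm unfolding visual_metric_def by blast
  have vis_low: "c1 * apow a (gromov_bdry b \<xi> \<eta>) \<le> d \<xi> \<eta>"
    and vis_up: "d \<xi> \<eta> \<le> c2 * apow a (gromov_bdry b \<xi> \<eta>)"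
    if "\<xi> \<in> boundary TYPE('a)" "\<eta> \<in> boundary TYPE('a)" for \<xi> \<eta>
    using vis that by blast+
  obtain \<pi> where \<pi>: "\<And>x. \<pi> x \<in> boundary TYPE('a)"
    "\<And>x. ereal (dist b0 x) \<le> gromov_pt_bdry b0 x (\<pi> x) + ereal D" using D(2) by metis
  define D' where "D' = D + 1 + 2 * dist b0 b"
  have D': "D' > 0" unfolding D'_def using D(1) by (simp add: add_pos_nonneg)
  have ev: "eventually (\<lambda>i. dist b x - D' \<le> gromov b x (u i)) sequentially" if "u \<in> \<pi> x" for x u
    unfolding D'_def by (rule visual_eventually[OF \<pi>(2) that])
  have lower: "ereal q \<le> gromov_bdry b \<xi> \<eta>"
    if "\<And>u v. u \<in> \<xi> \<Longrightarrow> v \<in> \<eta> \<Longrightarrow> eventually (\<lambda>i. q \<le> gromov b (u i) (v i)) sequentially" for q \<xi> \<eta>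
    unfolding gromov_bdry_def
  proof (intro INF_greatest Liminf_bounded)
    fix u v assume "u \<in> \<xi>" "v \<in> \<eta>"
    then show "eventually (\<lambda>i. ereal q \<le> ereal (gromov b (u i) (v i))) sequentially"
      using that[of u v] by simp
  qed
  \<comment> \<open>Moves the constant \<open>c1\<close> of the visual metric into the exponent; the
    sign of \<open>g\<close> is unknown.\<close>
  define g where "g = log a c1"
  have g: "a powr g = c1" using a by (simp add: g_def)
  define C where "C = Max {c2, c2 * a powr (D' + 2 * \<delta>), D' + \<bar>g\<bar> + 1 + 2 * \<delta>}"
  have C: "c2 \<le> C" "c2 * a powr (D' + 2 * \<delta>) \<le> C" "D' + \<bar>g\<bar> + 1 + 2 * \<delta> \<le> C"
    unfolding C_def by simp_all
  have bounded: "d \<xi> \<eta> \<le> C" if "\<xi> \<in> boundary TYPE('a)" "\<eta> \<in> boundary TYPE('a)" for \<xi> \<eta>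
  proof -
    have "apow a (gromov_bdry b \<xi> \<eta>) \<le> a powr - 0"
      using a by (intro apow_le lower) (auto simp: gromov_nonneg)
    then have "c2 * apow a (gromov_bdry b \<xi> \<eta>) \<le> c2 * 1" using a by (intro mult_left_mono) auto
    then show ?thesis using vis_up[OF that] C(1) by linarith
  qed
  have G1: "d (\<pi> x) (\<pi> y) \<le> C * a powr (- gromov b x y)" for x y
  proof -
    have "apow a (gromov_bdry b (\<pi> x) (\<pi> y)) \<le> a powr - (gromov b x y - D' - 2 * \<delta>)"
    proof (intro apow_le lower a)
      fix u v assume uv: "u \<in> \<pi> x" "v \<in> \<pi> y"
      show "eventually (\<lambda>i. gromov b x y - D' - 2 * \<delta> \<le> gromov b (u i) (v i)) sequentially"
        using ev[OF uv(1)] ev[OF uv(2)]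
      proof (rule eventually_elim2)
        fix i assume "dist b x - D' \<le> gromov b x (u i)" "dist b y - D' \<le> gromov b y (v i)"
        then show "gromov b x y - D' - 2 * \<delta> \<le> gromov b (u i) (v i)"
          using gromov_min2[OF \<delta>(2), of b "u i" x y "v i"] gromov_le_dist[of b x y] D'
          by (simp add: gromov_commute[of b "u i"])
      qed
    qed
    also have "\<dots> = a powr (D' + 2 * \<delta>) * a powr (- gromov b x y)"
      unfolding powr_add[symmetric] by (simp add: algebra_simps)
    finally have "c2 * apow a (gromov_bdry b (\<pi> x) (\<pi> y)) \<le> c2 * (a powr (D' + 2 * \<delta>) * a powr (- gromov b x y))"
      using a by (intro mult_left_mono) auto
    also have "\<dots> \<le> C * a powr (- gromov b x y)"
      using mult_right_mono[OF C(2), of "a powr (- gromov b x y)"] by (simp add: mult.assoc)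
    finally show ?thesis using vis_up[OF \<pi>(1) \<pi>(1), of x y] by linarith
  qed
  have G2: "G \<le> gromov b x y + C"
    if G: "G \<le> dist b x" "G \<le> dist b y" "d (\<pi> x) (\<pi> y) \<le> a powr (- G)" for x y G
  proof -
    obtain u v where uv: "u \<in> \<pi> x" "v \<in> \<pi> y" using boundary_nonempty \<pi>(1) by metis
    have "c1 * apow a (gromov_bdry b (\<pi> x) (\<pi> y)) \<le> a powr (- G)"
      using vis_low[OF \<pi>(1) \<pi>(1), of x y] G(3) by linarith
    \<comment> \<open>Rules out the value \<open>-\<infinity>\<close>, at which \<open>apow\<close>
      carries no information.\<close>
    moreover have "ereal 0 \<le> gromov_bdry b (\<pi> x) (\<pi> y)"
      by (rule lower) (simp add: gromov_nonneg)
    ultimately have "ereal (G + g) \<le> gromov_bdry b (\<pi> x) (\<pi> y)"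
    proof (cases "gromov_bdry b (\<pi> x) (\<pi> y)")
      case (real p)
      then have "a powr g * a powr (- p) \<le> a powr (- G)"
        using \<open>c1 * apow a (gromov_bdry b (\<pi> x) (\<pi> y)) \<le> a powr (- G)\<close> by (simp add: apow_def g)
      then have "a powr (g - p) \<le> a powr (- G)" by (simp flip: powr_add)
      then show ?thesis using a real by simp
    qed auto
    also have "\<dots> \<le> liminf (\<lambda>i. ereal (gromov b (u i) (v i)))"
      unfolding gromov_bdry_def using uv by (meson INF_lower order_trans)
    finally have le: "ereal (G + g) \<le> liminf (\<lambda>i. ereal (gromov b (u i) (v i)))" .
    have "ereal (G + g - 1) < ereal (G + g)" by simp
    then have "ereal (G + g - 1) < liminf (\<lambda>i. ereal (gromov b (u i) (v i)))" using le by (rule less_le_trans)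
    then have "eventually (\<lambda>i. ereal (G + g - 1) < ereal (gromov b (u i) (v i))) sequentially"
      by (rule less_LiminfD)
    then have "eventually (\<lambda>i. ereal (G + g - 1) < ereal (gromov b (u i) (v i)) \<and>
        dist b x - D' \<le> gromov b x (u i) \<and> dist b y - D' \<le> gromov b y (v i)) sequentially"
      using ev[OF uv(1)] ev[OF uv(2)] by (intro eventually_conj)
    then obtain i where "G + g - 1 < gromov b (u i) (v i)"
        "dist b x - D' \<le> gromov b x (u i)" "dist b y - D' \<le> gromov b y (v i)"
      using eventually_happens'[OF sequentially_bot] by force
    then have "G - (D' + \<bar>g\<bar> + 1 + 2 * \<delta>) \<le> gromov b x y"
      using gromov_min2[OF \<delta>(2), of b x "u i" "v i" y] G(1,2) D' by (simp add: gromov_commute[of b "v i"])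
    then show ?thesis using C(3) by linarith
  qed
  have "C > 0" using C(1) a by linarith
  then show ?thesis
    using a(1) \<pi>(1) bounded G1 G2 by (intro exI[of _ \<pi>] exI[of _ b] exI[of _ a] exI[of _ C]) auto
qed

section \<open>Spelling label sequences as reduced words\<close>

text \<open>The separator \<open>2\<close> in front of every bit makes all concatenations of letters reduced words.\<close>

definition letter :: "nat \<Rightarrow> nat \<Rightarrow> nat list" where
  "letter N x = concat (map (\<lambda>i. [2, if i = x then 1 else 0]) [0..<N])"

definition spell :: "nat \<Rightarrow> nat list \<Rightarrow> nat list" where
  "spell N xs = concat (map (letter N) xs)"

lemma length_letter: "length (letter N x) = 2 * N"
  unfolding letter_def by (simp add: length_concat comp_def sum_list_triv)

lemma length_spell: "length (spell N xs) = 2 * N * length xs"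
  unfolding spell_def by (simp add: length_concat comp_def length_letter sum_list_triv)

lemma letter_inj: "x < N \<Longrightarrow> letter N x = letter N y \<Longrightarrow> x = y"
proof -
  assume x: "x < N" and eq: "letter N x = letter N y"
  have "map (\<lambda>i. [2, if i = x then 1 else 0]) [0..<N] = map (\<lambda>i. [2, if i = y then 1 else (0::nat)]) [0..<N]"
    by (rule concat_injective) (use eq in \<open>auto simp: letter_def set_zip\<close>)
  then show "x = y" using x by (auto split: if_splits)
qed

lemma reduced_word_pairs:
  assumes "\<And>b. b \<in> set bs \<Longrightarrow> b < 2"
  shows "reduced_word (concat (map (\<lambda>b. [2, b]) bs))"
  using assms
proof (induction bs)
  case Nil
  then show ?case by (simp add: reduced_word_def)
next
  case (Cons b bs)
  let ?w = "concat (map (\<lambda>b. [2, b]) bs)"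
  have b: "b < 2" using Cons.prems by simp
  have IH: "reduced_word ?w" using Cons by simp
  have hd: "?w ! 0 = 2" if "0 < length ?w" using that by (cases bs) auto
  have "set (2 # b # ?w) \<subseteq> {0, 1, 2}" using IH b by (auto simp: reduced_word_def)
  moreover have "(2 # b # ?w) ! i \<noteq> (2 # b # ?w) ! Suc i" if "Suc i < length (2 # b # ?w)" for i
  proof -
    consider "i = 0" | "i = 1" | i' where "i = Suc (Suc i')" by (metis One_nat_def not0_implies_Suc)
    then show ?thesis
    proof cases
      case 2
      then show ?thesis using hd b that by simp
    next
      case 3
      then show ?thesis using IH that by (simp add: reduced_word_def)
    qed (use b in simp)
  qed
  ultimately show ?case by (simp add: reduced_word_def)
qed

lemma reduced_word_spell: "reduced_word (spell N xs)"
proof -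
  have "spell N xs = concat (map (\<lambda>b. [2, b]) (concat (map (\<lambda>x. map (\<lambda>i. if i = x then 1 else 0) [0..<N]) xs)))"
    unfolding spell_def letter_def by (induction xs) (auto simp: comp_def)
  then show ?thesis by (simp only:, intro reduced_word_pairs) (auto split: if_splits)
qed

lemma lcp_len_append_same: "lcp_len (p @ xs) (p @ ys) = length p + lcp_len xs ys"
  by (induction p) auto

lemma lcp_len_append_neq: "length p = length q \<Longrightarrow> p \<noteq> q \<Longrightarrow> lcp_len (p @ xs) (q @ ys) \<le> length p"
  by (induction p q rule: list_induct2) auto

text \<open>Two different letters may share a beginning of their codes, which costs at most one code
  length \<open>2 * N\<close>.\<close>

lemma lcp_len_spell:
  assumes "set xs \<subseteq> {..<N}"
  shows "2 * N * lcp_len xs ys \<le> lcp_len (spell N xs) (spell N ys) \<and>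
    lcp_len (spell N xs) (spell N ys) \<le> 2 * N * lcp_len xs ys + 2 * N"
  using assms
proof (induction xs ys rule: lcp_len.induct)
  case (1 x xs y ys)
  show ?case
  proof (cases "x = y")
    case True
    then show ?thesis using 1 by (simp add: spell_def lcp_len_append_same length_letter)
  next
    case False
    then have "letter N x \<noteq> letter N y" using letter_inj 1 by auto
    then have "lcp_len (letter N x @ spell N xs) (letter N y @ spell N ys) \<le> length (letter N x)"
      by (intro lcp_len_append_neq) (simp_all add: length_letter)
    then show ?thesis using False by (simp add: spell_def length_letter)
  qed
qed (auto simp: spell_def)

lemma tree_dist_spell:
  assumes "set xs \<subseteq> {..<N}"
    and W: "W = real (length xs) + real (length ys) - 2 * real (lcp_len xs ys)"
  shows "tree_dist (spell N xs, 0) (spell N ys, 0) \<le> 2 * real N * W"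
    "2 * real N * (W - 2) \<le> tree_dist (spell N xs, 0) (spell N ys, 0)"
proof -
  let ?l = "real (lcp_len (spell N xs) (spell N ys))"
  have td: "tree_dist (spell N xs, 0) (spell N ys, 0) = 2 * real N * (real (length xs) + real (length ys)) - 2 * ?l"
  proof -
    have "min (real (length (spell N xs))) (min (real (length (spell N ys))) ?l) = ?l"
      using lcp_len_le[of "spell N xs" "spell N ys"] by simp
    then have "tree_dist (spell N xs, 0) (spell N ys, 0) =
        real (length (spell N xs)) + real (length (spell N ys)) - 2 * ?l"
      by (simp add: tree_dist_def Let_def)
    then show ?thesis by (simp add: length_spell algebra_simps)
  qed
  have "2 * N * lcp_len xs ys \<le> lcp_len (spell N xs) (spell N ys)"
    "lcp_len (spell N xs) (spell N ys) \<le> 2 * N * lcp_len xs ys + 2 * N"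
    using lcp_len_spell[OF assms(1)] by auto
  then have "real (2 * N * lcp_len xs ys) \<le> ?l" "?l \<le> real (2 * N * lcp_len xs ys + 2 * N)"
    by (simp_all only: of_nat_le_iff)
  then show "tree_dist (spell N xs, 0) (spell N ys, 0) \<le> 2 * real N * W"
    "2 * real N * (W - 2) \<le> tree_dist (spell N xs, 0) (spell N ys, 0)"
    unfolding td W by (simp_all add: algebra_simps)
qed

section \<open>The embedding\<close>

text \<open>The path distance between \<open>xs\<close> and \<open>ys\<close> in the tree of all
  words.\<close>

definition word_dist :: "nat list \<Rightarrow> nat list \<Rightarrow> real" where
  "word_dist xs ys = real (length xs) + real (length ys) - 2 * real (lcp_len xs ys)"

lemma word_dist_ge: "real (length ys) - real (lcp_len xs ys) \<le> word_dist xs ys"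
  unfolding word_dist_def using lcp_len_le[of xs ys] by linarith

lemma word_dist_ge_diff: "real (length ys) - real (length xs) \<le> word_dist xs ys"
  unfolding word_dist_def using lcp_len_le[of xs ys] by linarith

lemma word_dist_nonneg: "0 \<le> word_dist xs ys"
  unfolding word_dist_def using lcp_len_le[of xs ys] by linarith

lemma word_dist_commute: "word_dist xs ys = word_dist ys xs"
  unfolding word_dist_def using lcp_len_commute[of xs ys] by simp

lemma exists_divergence_level:
  fixes r \<epsilon> D :: real
  assumes "0 < r" "r < 1" "0 < \<epsilon>" "0 < D"
  shows "\<exists>k::nat. (k = 0 \<or> D < \<epsilon> * r ^ k) \<and> \<epsilon> * r ^ Suc k \<le> D"
proof -
  obtain m where "r ^ m < D / \<epsilon>" using real_arch_pow_inv[of "D / \<epsilon>" r] assms by auto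
  then have ex: "\<exists>m. \<epsilon> * r ^ m \<le> D"
    using assms by (intro exI[of _ m]) (simp add: field_simps)
  define m0 where "m0 = (LEAST m. \<epsilon> * r ^ m \<le> D)"
  have m0: "\<epsilon> * r ^ m0 \<le> D" unfolding m0_def using ex by (rule LeastI_ex)
  show ?thesis
  proof (cases m0)
    case 0
    have "\<epsilon> * r ^ Suc 0 \<le> \<epsilon> * r ^ 0" using assms by simp
    then show ?thesis using m0 0 by (intro exI[of _ 0]) simp
  next
    case (Suc k)
    then have "\<not> \<epsilon> * r ^ k \<le> D" unfolding m0_def using not_less_Least by (metis lessI)
    then show ?thesis using m0 Suc by (intro exI[of _ k]) (simp add: not_le)
  qed
qed

section \<open>Words of all colours against levels of the boundary\<close>

lemma exists_words:
  fixes B :: "'b set"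
  assumes met: "metric_on B d" and cd: "cdim_cond B d n" and dbl: "doubling B d"
    and bnd: "\<And>x y. x \<in> B \<Longrightarrow> y \<in> B \<Longrightarrow> d x y \<le> \<Delta>"
  obtains r \<epsilon> A :: real and N :: nat and w :: "nat \<Rightarrow> 'b \<Rightarrow> nat \<Rightarrow> nat list"
  where "0 < r" "r < 1" "0 < \<epsilon>" "0 < A" "1 \<le> N"
    and "\<And>c z t. set (w c z t) \<subseteq> {..<N}"
    and "\<And>c z z' m t t'. z \<in> B \<Longrightarrow> z' \<in> B \<Longrightarrow> m = 0 \<or> d z z' < \<epsilon> * r ^ m \<Longrightarrow> m \<le> t \<Longrightarrow> m \<le> t' \<Longrightarrow>
      word_dist (w c z t) (w c z' t') \<le> real (t - m) + real (t' - m) + 2"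
    and "\<And>z z' t t'. z \<in> B \<Longrightarrow> z' \<in> B \<Longrightarrow> t \<le> t' \<Longrightarrow> \<exists>k\<le>t. (k = 0 \<or> d z z' < \<epsilon> * r ^ k) \<and>
      real (t' - k) \<le> A * (\<Sum>c\<le>n. word_dist (w c z t) (w c z' t')) + A"
proof -
  interpret metric_carrier B d by unfold_locales (rule met)
  obtain T \<beta> where T: "T > 0" and \<beta>: "\<beta> > 0" "\<beta> \<le> 1"
    and cores: "\<And>\<tau>. 0 < \<tau> \<and> \<tau> \<le> T \<Longrightarrow> \<exists>Q. core_cover n \<beta> \<tau> Q"
    using cdim_cores[OF cd] by blast
  define r where "r = \<beta> / 16"
  have r: "r > 0" "r < 1" "r \<le> \<beta> / 16" using \<beta> by (auto simp: r_def)
  define R where "R l = T * r ^ l" for l :: nat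
  have R: "0 < R l \<and> R l \<le> T" for l
    using T r power_le_one[of r l] by (auto simp: R_def mult_le_cancel_left1)
  have "\<forall>l. \<exists>Q. core_cover n \<beta> (R l) Q" using cores R by blast
  then obtain Q where Q: "\<And>l. core_cover n \<beta> (R l) (Q l)" by metis
  define P where "P c l = Q l c" for c l
  have Q1: "\<forall>c. \<forall>V\<in>Q l c. V \<noteq> {} \<and> V \<subseteq> B \<and> (\<forall>x\<in>V. \<forall>y\<in>V. d x y \<le> R l)"
    and Q2: "\<forall>c. \<forall>V\<in>Q l c. \<forall>W\<in>Q l c. V \<noteq> W \<longrightarrow> (\<forall>x\<in>V. \<forall>y\<in>W. d x y > \<beta> * R l)"
    and Q3: "\<forall>z\<in>B. \<exists>c\<le>n. \<exists>V\<in>Q l c. z \<in> V" for l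
    using Q[of l, unfolded core_cover_def] by (rule conjunct1, rule conjunct2[THEN conjunct1], rule conjunct2[THEN conjunct2])
  have fam: "core_family B d (P c) R T r \<beta>" for c
  proof
    show "R l = T * r ^ l" for l by (rule R_def)
    fix V l assume "V \<in> P c l"
    then have V: "V \<in> Q l c" by (simp add: P_def)
    note V1 = bspec[OF spec[OF Q1] V]
    show "V \<noteq> {}" "V \<subseteq> B" using V1 by simp_all
    show "d x y \<le> R l" if "x \<in> V" "y \<in> V" for x y using V1 that by simp
    show "\<beta> * R l < d x y" if "W \<in> P c l" "V \<noteq> W" "x \<in> V" "y \<in> W" for W x y
      using bspec[OF bspec[OF spec[OF Q2] V], of W] that by (simp add: P_def)
  qed (use T \<beta> r in auto)
  define ent where "ent c = core_family.entries B d (P c) R \<beta>" for c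
  define \<epsilon> where "\<epsilon> = \<beta> / 8 * T"
  have \<epsilon>: "\<epsilon> > 0" "\<beta> / 8 * R m = \<epsilon> * r ^ m" for m using T \<beta> by (auto simp: \<epsilon>_def R_def)
  have covered: "real (t' - i) \<le> (\<Sum>c\<le>n. real (length (ent c z i t')))" if z: "z \<in> B" for z i t'
  proof -
    have "{i..<t'} \<subseteq> (\<Union>c\<le>n. {l \<in> {i..<t'}. \<exists>V. core_family.env B d (P c) R \<beta> l V z})"
    proof
      fix l assume l: "l \<in> {i..<t'}"
      obtain c V where c: "c \<le> n" "V \<in> P c l" "z \<in> V"
        using bspec[OF Q3 z, of l] unfolding P_def by blast
      then have "core_family.env B d (P c) R \<beta> l V z" using core_family.env.base[OF fam] by blast
      then show "l \<in> (\<Union>c\<le>n. {l \<in> {i..<t'}. \<exists>V. core_family.env B d (P c) R \<beta> l V z})"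
        using l c(1) by blast
    qed
    then have "card {i..<t'} \<le> card (\<Union>c\<le>n. {l \<in> {i..<t'}. \<exists>V. core_family.env B d (P c) R \<beta> l V z})"
      by (intro card_mono) auto
    also have "\<dots> \<le> (\<Sum>c\<le>n. card {l \<in> {i..<t'}. \<exists>V. core_family.env B d (P c) R \<beta> l V z})"
      by (rule card_UN_le) simp
    also have "\<dots> = (\<Sum>c\<le>n. length (ent c z i t'))"
      unfolding ent_def by (simp add: core_family.length_entries[OF fam])
    finally have "t' - i \<le> (\<Sum>c\<le>n. length (ent c z i t'))" by simp
    then have "real (t' - i) \<le> real (\<Sum>c\<le>n. length (ent c z i t'))" by (rule of_nat_mono)
    then show ?thesis by simp
  qed
  \<comment> \<open>Far enough below the divergence level that
    \<open>2 * R (k + j1) < \<epsilon> * r ^ Suc k \<le> d z z'\<close>.\<close>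
  obtain j1 where j1: "r ^ j1 < \<beta> / 16 * r" using real_arch_pow_inv[of "\<beta> / 16 * r" r] \<beta> r by auto
  \<comment> \<open>The term \<open>\<beta> / 8\<close> serves \<open>k > 0\<close>; for
    \<open>k = 0\<close> the scale is \<open>T\<close> and only \<open>\<Delta>\<close> bounds the
    distance.\<close>
  define D where "D = max 0 (\<beta> / 8 + \<Delta> / T)"
  define K where "K = 4 + D"
  \<comment> \<open>A colour with an average share of entries has
    \<open>t' - \<kappa> \<le> (n + 1) * p\<close> with \<open>p \<le> 3 * j\<close>; the
    \<open>j1\<close> levels between \<open>k\<close> and \<open>\<kappa>\<close> are added.\<close>
  define L where "L = 3 * (n + 1) + j1"
  have D: "D \<ge> 0" "\<beta> / 8 + \<Delta> / T \<le> D" by (auto simp: D_def)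
  have K: "K \<ge> 1" using D by (simp add: K_def)
  define cf where "cf c lab \<longleftrightarrow>
    (\<forall>(u, u', j)\<in>core_family.conflicts B d (P c) R r \<beta> L K.
       map lab (core_family.tail B d (P c) R \<beta> j u) \<noteq> map lab (core_family.tail B d (P c) R \<beta> j u'))"
    for c and lab :: "nat \<times> 'b set \<Rightarrow> nat"
  have "\<exists>N\<ge>1. \<exists>lab. (\<forall>v. lab v < N) \<and> cf c lab" for c
    unfolding cf_def by (rule core_family.exists_conflict_free_labelling[OF fam dbl K])
  then obtain Nc and lab :: "nat \<Rightarrow> nat \<times> 'b set \<Rightarrow> nat"
    where lab: "\<And>c. Nc c \<ge> (1::nat)" "\<And>c v. lab c v < Nc c" "\<And>c. cf c (lab c)"
    by metis
  define N where "N = (\<Sum>c\<le>n. Nc c)"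
  have Nc: "Nc c \<le> N" if "c \<le> n" for c unfolding N_def using that by (intro member_le_sum) auto
  define w where "w c z t = (if c \<le> n then map (lab c) (ent c z 0 t) else [])" for c z t
  have N: "1 \<le> N" using Nc[of 0] lab(1)[of 0] by simp
  have letters: "set (w c z t) \<subseteq> {..<N}" for c z t
    using lab(2)[of c] Nc[of c] by (auto simp: w_def intro: less_le_trans)
  have upper: "word_dist (w c z t) (w c z' t') \<le> real (t - m) + real (t' - m) + 2"
    if "z \<in> B" "z' \<in> B" "m = 0 \<or> d z z' < \<epsilon> * r ^ m" "m \<le> t" "m \<le> t'" for c z z' m t t'
  proof (cases "c \<le> n")
    case True
    have "length (ent c z 0 t) + length (ent c z' 0 t') \<le>
      2 * lcp_len (map (lab c) (ent c z 0 t)) (map (lab c) (ent c z' 0 t')) + (t - m) + (t' - m) + 2"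
      unfolding ent_def using core_family.word_dist_upper[OF fam that(1,2) _ that(4,5)] that(3) \<epsilon>(2) by simp
    then have "real (length (ent c z 0 t) + length (ent c z' 0 t')) \<le>
      real (2 * lcp_len (map (lab c) (ent c z 0 t)) (map (lab c) (ent c z' 0 t')) + (t - m) + (t' - m) + 2)"
      by (rule of_nat_mono)
    then show ?thesis using True by (simp add: w_def word_dist_def)
  qed (simp add: w_def word_dist_def)
  define A where "A = 2 * (real n + 1) + real j1 + real n + 1"
  have A: "A > 0" "2 * (real n + 1) \<le> A" "1 \<le> A" by (auto simp: A_def)
  let ?S = "\<lambda>z z' t t'. \<Sum>c\<le>n. word_dist (w c z t) (w c z' t')"
  have S_nonneg: "0 \<le> ?S z z' t t'" for z z' t t' by (intro sum_nonneg word_dist_nonneg)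
  have lower: "\<exists>k\<le>t. (k = 0 \<or> d z z' < \<epsilon> * r ^ k) \<and> real (t' - k) \<le> A * ?S z z' t t' + A"
    if z: "z \<in> B" "z' \<in> B" and t: "t \<le> t'" for z z' t t'
  proof (cases "t = 0 \<or> d z z' < \<epsilon> * r ^ t")
    case True
    \<comment> \<open>The points are not yet separated at level \<open>t\<close>, so
      \<open>k = t\<close> works: the surplus entries of \<open>z'\<close> beyond \<open>t\<close>
      show up as a difference of lengths, up to one entry per colour.\<close>
    have "real (t' - t) \<le> (\<Sum>c\<le>n. real (length (ent c z' t t')))" by (rule covered[OF z(2)])
    also have "\<dots> \<le> (\<Sum>c\<le>n. word_dist (w c z t) (w c z' t') + 1)"
    proof (rule sum_mono)
      fix c assume c: "c \<in> {..n}"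
      have "length (ent c z 0 t) \<le> length (ent c z' 0 t) + 1"
        unfolding ent_def using core_family.length_entries_close[OF fam z, of t] True \<epsilon>(2) by simp
      moreover have "ent c z' 0 t' = ent c z' 0 t @ ent c z' t t'"
        unfolding ent_def by (rule core_family.entries_append[OF fam]) (use t in auto)
      ultimately have "real (length (ent c z' t t')) - 1 \<le> real (length (w c z' t')) - real (length (w c z t))"
        using c by (simp add: w_def)
      then show "real (length (ent c z' t t')) \<le> word_dist (w c z t) (w c z' t') + 1"
        using word_dist_ge_diff[of "w c z' t'" "w c z t"] by linarith
    qed
    also have "\<dots> = 1 * ?S z z' t t' + (real n + 1)" by (simp add: sum.distrib)
    also have "\<dots> \<le> A * ?S z z' t t' + A"
      using A S_nonneg[of z t z' t'] by (intro add_mono mult_right_mono) auto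
    finally show ?thesis using True by blast
  next
    case False
    then have dpos: "d z z' > 0" using \<epsilon>(1) r by (meson less_le_trans linorder_not_less mult_pos_pos zero_less_power)
    obtain k where k: "k = 0 \<or> d z z' < \<epsilon> * r ^ k" "\<epsilon> * r ^ Suc k \<le> d z z'"
      using exists_divergence_level[OF r(1,2) \<epsilon>(1) dpos] by blast
    have kt: "k \<le> t"
    proof (rule ccontr)
      assume "\<not> k \<le> t"
      then have "r ^ k \<le> r ^ t" using r by (intro power_decreasing) auto
      then have "\<epsilon> * r ^ k \<le> \<epsilon> * r ^ t" using \<epsilon>(1) by simp
      then show False using k(1) False \<open>\<not> k \<le> t\<close> by auto
    qed
    define \<kappa> where "\<kappa> = k + j1"
    have "real (t' - k) \<le> A * ?S z z' t t' + A"
    proof (cases "\<kappa> \<le> t'")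
      case False
      then have "real (t' - k) \<le> real j1" by (simp add: \<kappa>_def)
      also have "\<dots> \<le> A" by (simp add: A_def)
      finally show ?thesis using A S_nonneg[of z t z' t'] by (simp add: add_increasing)
    next
      case \<kappa>t: True
      have "\<exists>c\<le>n. real (t' - \<kappa>) \<le> (real n + 1) * real (length (ent c z' \<kappa> t'))"
      proof (rule ccontr)
        assume "\<not> ?thesis"
        then have less: "real (length (ent c z' \<kappa> t')) < real (t' - \<kappa>) / (real n + 1)" if "c \<le> n" for c
          using that by (force simp: field_simps)
        have "(\<Sum>c\<le>n. real (length (ent c z' \<kappa> t'))) < (\<Sum>c\<le>n. real (t' - \<kappa>) / (real n + 1))"
          by (intro sum_strict_mono less) auto
        also have "\<dots> = real (t' - \<kappa>)" by (simp add: field_simps)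
        finally show False using covered[OF z(2), of t' \<kappa>] by linarith
      qed
      then obtain c where c: "c \<le> n" "real (t' - \<kappa>) \<le> (real n + 1) * real (length (ent c z' \<kappa> t'))" by blast
      define p where "p = length (ent c z' \<kappa> t')"
      have W: "real p \<le> 2 * word_dist (w c z t) (w c z' t') + 1"
      proof (cases "p \<le> 1")
        case True
        then show ?thesis using word_dist_nonneg[of "w c z t" "w c z' t'"] by linarith
      next
        case False
        \<comment> \<open>Half of the entries are given up to the labelling; the other
          \<open>p - j \<ge> p / 2\<close> count towards the distance.\<close>
        define j where "j = p div 2"
        have j: "1 \<le> j" "j + 1 \<le> p" "p \<le> 3 * j" using False by (auto simp: j_def)
        have "t' \<le> k + L * j"
        proof -
          have "real (t' - \<kappa>) \<le> real ((n + 1) * p)" using c(2) by (simp add: p_def algebra_simps)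
          then have "t' - \<kappa> \<le> (n + 1) * p" by (simp only: of_nat_le_iff)
          also have "\<dots> \<le> (n + 1) * (3 * j)" using j(3) by (rule mult_left_mono) simp
          finally have "t' \<le> k + j1 * 1 + (n + 1) * (3 * j)" using \<kappa>t by (simp add: \<kappa>_def)
          also have "\<dots> \<le> k + j1 * j + (n + 1) * (3 * j)" using j(1) by simp
          finally show ?thesis by (simp add: L_def algebra_simps)
        qed
        moreover have "2 * R \<kappa> < d z z'"
        proof -
          have "2 * R \<kappa> = 2 * T * r ^ k * r ^ j1" by (simp add: R_def \<kappa>_def power_add)
          also have "\<dots> < 2 * T * r ^ k * (\<beta> / 16 * r)" using j1 T r by (intro mult_strict_left_mono) auto
          also have "\<dots> = \<epsilon> * r ^ Suc k" by (simp add: \<epsilon>_def)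
          finally show ?thesis using k(2) by linarith
        qed
        moreover have "d z z' \<le> D * R k"
        proof (cases "k = 0")
          case True
          have "d z z' \<le> \<Delta>" using bnd z by blast
          also have "\<dots> \<le> (\<beta> / 8 + \<Delta> / T) * T" using T \<beta> by (simp add: algebra_simps)
          also have "\<dots> \<le> D * T" using D(2) T by (intro mult_right_mono) auto
          finally show ?thesis using True by (simp add: R_def)
        next
          case False
          have "d z z' \<le> \<beta> / 8 * R k" using False k(1) \<epsilon>(2) by simp
          also have "\<dots> \<le> D * R k"
          proof (rule mult_right_mono)
            have "0 \<le> \<Delta>" using bnd[OF z] dpos by simp
            then show "\<beta> / 8 \<le> D" using D(2) T divide_nonneg_pos[of \<Delta> T] by linarith
          qed (use R in \<open>simp add: less_imp_le\<close>)
          finally show ?thesis .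
        qed
        ultimately have "lcp_len (map (lab c) (ent c z 0 t)) (map (lab c) (ent c z' 0 t')) \<le> length (ent c z' 0 \<kappa>) + j"
          unfolding ent_def
          using core_family.word_dist_lower[OF fam lab(3)[of c, unfolded cf_def] _ D(1) z _ _ _ _ kt t \<kappa>t j(1)] k(1) \<epsilon>(2) j(2)
          by (simp add: K_def \<kappa>_def p_def ent_def)
        moreover have "length (ent c z' 0 t') = length (ent c z' 0 \<kappa>) + p"
          unfolding p_def ent_def using core_family.entries_append[OF fam, of 0 \<kappa> t' c z'] \<kappa>t by simp
        ultimately have "real (length (w c z' t')) - real (lcp_len (w c z t) (w c z' t')) \<ge> real p - real j"
          using c(1) by (simp add: w_def)
        moreover have "2 * real j \<le> real p" by (simp add: j_def)
        ultimately show ?thesis using word_dist_ge[of "w c z' t'" "w c z t"] by linarith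
      qed
      have "word_dist (w c z t) (w c z' t') \<le> ?S z z' t t'"
        using c(1) by (intro member_le_sum) (auto simp: word_dist_nonneg)
      then have "real p \<le> 2 * ?S z z' t t' + 1" using W by linarith
      then have "(real n + 1) * real p \<le> (real n + 1) * (2 * ?S z z' t t' + 1)" by (intro mult_left_mono) auto
      then have "real (t' - \<kappa>) \<le> (2 * (real n + 1)) * ?S z z' t t' + (real n + 1)"
        using c(2) by (simp add: p_def algebra_simps)
      moreover have "(2 * (real n + 1)) * ?S z z' t t' \<le> A * ?S z z' t t'"
        using A(2) S_nonneg by (intro mult_right_mono) auto
      moreover have "real (t' - k) = real (t' - \<kappa>) + real j1" using \<kappa>t by (simp add: \<kappa>_def)
      moreover have "real n + 1 + real j1 \<le> A" by (simp add: A_def)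
      ultimately show ?thesis by linarith
    qed
    then show ?thesis using k(1) kt by blast
  qed
  show thesis by (rule that[OF r(1,2) \<epsilon>(1) A(1) N letters upper lower])
qed

text \<open>Since \<open>dist x y = h x + h y - 2 * gromov b x y\<close>, it suffices to round
  heights to levels: in units of \<open>\<tau>\<close> and up to a constant, the Gromov product is
  the level at which the boundary points part, and the words detect that level.\<close>

theorem theorem1p2:
  fixes d :: "(nat \<Rightarrow> 'a::metric_space) set \<Rightarrow> (nat \<Rightarrow> 'a) set \<Rightarrow> real"
    and n :: nat
  assumes "hyperbolic TYPE('a)"
    and "visual_space TYPE('a)"
    and "visual_metric TYPE('a) d"
    and "doubling (boundary TYPE('a)) d"
    and "cdim (boundary TYPE('a)) d = enat n"
  shows "\<exists>f :: 'a \<Rightarrow> (nat \<Rightarrow> nat list \<times> real). qi_embedding f (tree_power n) (tree_power_dist n)"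
proof -
  let ?B = "boundary TYPE('a)"
  have met: "metric_on ?B d" using assms(3) unfolding visual_metric_def by blast
  have cd: "cdim_cond ?B d n"
    using assms(5) LeastI_ex[of "cdim_cond ?B d"] by (auto simp: cdim_def split: if_splits)
  obtain \<pi> :: "'a \<Rightarrow> (nat \<Rightarrow> 'a) set" and b a C where a: "a > 1" and C: "C > 0"
    and \<pi>: "\<And>x. \<pi> x \<in> ?B"
    and bnd: "\<And>\<xi> \<eta>. \<xi> \<in> ?B \<Longrightarrow> \<eta> \<in> ?B \<Longrightarrow> d \<xi> \<eta> \<le> C"
    and G1: "\<And>x y. d (\<pi> x) (\<pi> y) \<le> C * a powr (- gromov b x y)"
    and G2: "\<And>x y G. G \<le> dist b x \<Longrightarrow> G \<le> dist b y \<Longrightarrow> d (\<pi> x) (\<pi> y) \<le> a powr (- G) \<Longrightarrow> G \<le> gromov b x y + C"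
    using boundary_projection[OF assms(1-3)] by blast
  obtain r \<epsilon> A :: real and N :: nat and w :: "nat \<Rightarrow> (nat \<Rightarrow> 'a) set \<Rightarrow> nat \<Rightarrow> nat list"
    where r: "0 < r" "r < 1" and \<epsilon>: "0 < \<epsilon>" and A: "0 < A" and N: "1 \<le> N"
    and letters: "\<And>c z t. set (w c z t) \<subseteq> {..<N}"
    and upper: "\<And>c z z' m t t'. z \<in> ?B \<Longrightarrow> z' \<in> ?B \<Longrightarrow> m = 0 \<or> d z z' < \<epsilon> * r ^ m \<Longrightarrow> m \<le> t \<Longrightarrow> m \<le> t' \<Longrightarrow>
      word_dist (w c z t) (w c z' t') \<le> real (t - m) + real (t' - m) + 2"
    and lower: "\<And>z z' t t'. z \<in> ?B \<Longrightarrow> z' \<in> ?B \<Longrightarrow> t \<le> t' \<Longrightarrow> \<exists>k\<le>t. (k = 0 \<or> d z z' < \<epsilon> * r ^ k) \<and>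
      real (t' - k) \<le> A * (\<Sum>c\<le>n. word_dist (w c z t) (w c z' t')) + A"
    using exists_words[OF met cd assms(4), of C] bnd by blast
  define \<tau> where "\<tau> = - log a r"
  have \<tau>: "\<tau> > 0" using a r by (simp add: \<tau>_def log_less_zero_cancel_iff)
  have r_pow: "r ^ m = a powr (- (\<tau> * real m))" for m
  proof -
    have "r = a powr (- \<tau>)" using a r by (simp add: \<tau>_def)
    then have "r ^ m = (a powr (- \<tau>)) ^ m" by simp
    also have "\<dots> = (a powr (- \<tau>)) powr real m" using a by (intro powr_realpow[symmetric]) simp
    also have "\<dots> = a powr (- (\<tau> * real m))" by (simp add: powr_powr)
    finally show ?thesis .
  qed
  define h where "h x = dist b x" for x
  define t where "t x = nat \<lfloor>h x / \<tau>\<rfloor>" for x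
  have t: "\<tau> * real (t x) \<le> h x" "h x < \<tau> * (real (t x) + 1)" for x
  proof -
    have "0 \<le> h x / \<tau>" using \<tau> by (simp add: h_def)
    then have "real (t x) = of_int \<lfloor>h x / \<tau>\<rfloor>" by (simp add: t_def)
    then have "real (t x) \<le> h x / \<tau>" "h x / \<tau> < real (t x) + 1" by linarith+
    then show "\<tau> * real (t x) \<le> h x" "h x < \<tau> * (real (t x) + 1)" using \<tau> by (simp_all add: field_simps)
  qed
  have dist_eq: "dist x y = h x + h y - 2 * gromov b x y" for x y
    unfolding gromov_def h_def by argo
  define wd where "wd x y = (\<Sum>c\<le>n. word_dist (w c (\<pi> x) (t x)) (w c (\<pi> y) (t y)))" for x y
  have wd_commute: "wd x y = wd y x" for x y unfolding wd_def by (simp add: word_dist_commute)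
  \<comment> \<open>The shift that pays for both constants:
    \<open>C * a powr (- b0) < \<epsilon>\<close>.\<close>
  define b0 where "b0 = log a (max 1 (C / \<epsilon>)) + 1"
  have b0: "b0 \<ge> 0" "C < \<epsilon> * a powr b0"
  proof -
    have "0 \<le> log a (max 1 (C / \<epsilon>))" using a by simp
    then show "b0 \<ge> 0" by (simp add: b0_def)
    have "C / \<epsilon> \<le> a powr (log a (max 1 (C / \<epsilon>)))" using a by simp
    also have "\<dots> < a powr b0" unfolding b0_def using a by (intro powr_less_mono) auto
    finally show "C < \<epsilon> * a powr b0" using \<epsilon> by (simp add: field_simps)
  qed
  have wd_upper: "wd x y \<le> (real n + 1) / \<tau> * dist x y + (real n + 1) * (2 * b0 / \<tau> + 4)" for x y
  proof -
    define p where "p = gromov b x y"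
    have p: "0 \<le> p" "p \<le> h x" "p \<le> h y"
      unfolding p_def h_def by (simp_all add: gromov_nonneg gromov_le_dist)
    define m where "m = nat \<lfloor>(p - b0) / \<tau>\<rfloor>"
    have m_le: "m \<le> t x" if "p \<le> h x" for x
    proof -
      have "(p - b0) / \<tau> \<le> h x / \<tau>" using that b0 \<tau> by (intro divide_right_mono) auto
      then show ?thesis unfolding m_def t_def by (intro nat_mono floor_mono)
    qed
    have m_gt: "(p - b0) / \<tau> < real m + 1" unfolding m_def by linarith
    have close: "m = 0 \<or> d (\<pi> x) (\<pi> y) < \<epsilon> * r ^ m"
    proof (cases "m = 0")
      case False
      then have "real m \<le> (p - b0) / \<tau>" unfolding m_def by linarith
      then have "\<tau> * real m \<le> p - b0" using \<tau> by (simp add: field_simps)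
      then have le: "a powr (b0 - p) \<le> r ^ m" unfolding r_pow using a by simp
      have "d (\<pi> x) (\<pi> y) \<le> C * a powr (- p)" unfolding p_def by (rule G1)
      also have "\<dots> < (\<epsilon> * a powr b0) * a powr (- p)" using b0 a by (intro mult_strict_right_mono) auto
      also have "\<dots> = \<epsilon> * a powr (b0 - p)" by (simp add: powr_diff powr_minus field_simps)
      also have "\<dots> \<le> \<epsilon> * r ^ m" using le \<epsilon> by simp
      finally show ?thesis by simp
    qed simp
    have one: "real (t x - m) \<le> (h x - p + b0) / \<tau> + 1" if "p \<le> h x" for x
    proof -
      have "real (t x) \<le> h x / \<tau>" using t(1)[of x] \<tau> by (simp add: field_simps)
      then have "real (t x) - real m \<le> h x / \<tau> - (p - b0) / \<tau> + 1" using m_gt by linarith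
      also have "\<dots> = (h x - p + b0) / \<tau> + 1" by (simp add: diff_divide_distrib add_divide_distrib)
      finally show ?thesis using m_le[OF that] by (simp add: of_nat_diff)
    qed
    have "wd x y \<le> (\<Sum>c\<le>n. real (t x - m) + real (t y - m) + 2)"
      unfolding wd_def using upper[OF \<pi> \<pi> close m_le[OF p(2)] m_le[OF p(3)]] by (intro sum_mono)
    also have "\<dots> = (real n + 1) * (real (t x - m) + real (t y - m) + 2)" by simp
    also have "\<dots> \<le> (real n + 1) * (((h x - p + b0) / \<tau> + 1) + ((h y - p + b0) / \<tau> + 1) + 2)"
      using one p by (intro mult_left_mono add_mono) auto
    also have "\<dots> = (real n + 1) / \<tau> * dist x y + (real n + 1) * (2 * b0 / \<tau> + 4)"
      unfolding dist_eq p_def using \<tau> by (simp add: field_simps)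
    finally show ?thesis .
  qed
  \<comment> \<open>One constant for both cases: \<open>C\<close> bounds the distance when
    \<open>k = 0\<close>, \<open>\<epsilon> * r ^ k\<close> otherwise; the lower bound
    \<open>1\<close> gives \<open>g \<ge> 0\<close>.\<close>
  define F where "F = max 1 (\<epsilon> + C)"
  define g where "g = log a F"
  have F: "F \<ge> 1" "\<epsilon> \<le> F" "C \<le> F" using \<epsilon> C by (auto simp: F_def)
  have g: "g \<ge> 0" "a powr g = F" using a F by (auto simp: g_def)
  define E where "E = 2 * \<tau> * A + 2 * \<tau> + 2 * g + 2 * C"
  have wd_lower': "dist x y \<le> 2 * \<tau> * A * wd x y + E" if le: "t x \<le> t y" for x y
  proof -
    obtain k where k: "k \<le> t x" "k = 0 \<or> d (\<pi> x) (\<pi> y) < \<epsilon> * r ^ k" "real (t y - k) \<le> A * wd x y + A"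
      unfolding wd_def using lower[OF \<pi> \<pi> le] by blast
    have "d (\<pi> x) (\<pi> y) \<le> F * r ^ k"
    proof (cases "k = 0")
      case True
      then show ?thesis using bnd[OF \<pi> \<pi>, of x y] F by simp
    next
      case False
      then have "d (\<pi> x) (\<pi> y) \<le> \<epsilon> * r ^ k" using k by simp
      also have "\<dots> \<le> F * r ^ k" using F r by (intro mult_right_mono) auto
      finally show ?thesis .
    qed
    also have "\<dots> = a powr (- (\<tau> * real k - g))"
      unfolding r_pow g(2)[symmetric] powr_add[symmetric] by simp
    finally have d: "d (\<pi> x) (\<pi> y) \<le> a powr (- (\<tau> * real k - g))" .
    have "\<tau> * real k \<le> \<tau> * real (t x)" "\<tau> * real k \<le> \<tau> * real (t y)" using k(1) le \<tau> by simp_all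
    then have kh: "\<tau> * real k - g \<le> h x" "\<tau> * real k - g \<le> h y" using t(1)[of x] t(1)[of y] g(1) by linarith+
    have G: "\<tau> * real k - g \<le> gromov b x y + C" by (rule G2) (use kh d in \<open>simp_all add: h_def\<close>)
    have "dist x y \<le> \<tau> * (real (t x) + 1) + \<tau> * (real (t y) + 1) - 2 * (\<tau> * real k - g - C)"
      unfolding dist_eq using t(2)[of x] t(2)[of y] G by (simp add: algebra_simps)
    \<comment> \<open>Both heights are replaced by the larger level, because the word estimate
      controls \<open>t y - k\<close>.\<close>
    also have "\<dots> \<le> \<tau> * (real (t y) + 1) + \<tau> * (real (t y) + 1) - 2 * (\<tau> * real k - g - C)"
      using le \<tau> by simp
    also have "\<dots> = 2 * \<tau> * real (t y - k) + 2 * \<tau> + 2 * g + 2 * C"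
      using k(1) le by (simp add: of_nat_diff algebra_simps)
    also have "\<dots> \<le> 2 * \<tau> * (A * wd x y + A) + 2 * \<tau> + 2 * g + 2 * C"
      using k(3) \<tau> by (intro add_mono mult_left_mono) auto
    also have "\<dots> = 2 * \<tau> * A * wd x y + E" by (simp add: E_def algebra_simps)
    finally show ?thesis .
  qed
  have wd_lower: "dist x y \<le> 2 * \<tau> * A * wd x y + E" for x y
    using wd_lower'[of x y] wd_lower'[of y x] wd_commute[of x y]
    by (cases "t x \<le> t y") (auto simp: dist_commute)
  have E: "E \<ge> 0" unfolding E_def using \<tau> A g C by (auto intro!: add_nonneg_nonneg)
  define f where "f x c = (spell N (w c (\<pi> x) (t x)), 0::real)" for x and c :: nat
  have in_tree: "f x \<in> tree_power n" for x
    by (auto simp: tree_power_def bin_tree_def f_def reduced_word_spell)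
  let ?M = "2 * real N"
  have f_upper: "tree_power_dist n (f x) (f y) \<le> ?M * wd x y" for x y
    unfolding tree_power_dist_def wd_def f_def sum_distrib_left
    by (intro sum_mono tree_dist_spell(1)[OF letters]) (simp add: word_dist_def)
  have f_lower: "?M * wd x y - 2 * ?M * (real n + 1) \<le> tree_power_dist n (f x) (f y)" for x y
  proof -
    have "(\<Sum>c\<le>n. ?M * (word_dist (w c (\<pi> x) (t x)) (w c (\<pi> y) (t y)) - 2)) \<le> tree_power_dist n (f x) (f y)"
      unfolding tree_power_dist_def f_def
      by (intro sum_mono tree_dist_spell(2)[OF letters]) (simp add: word_dist_def)
    also have "(\<Sum>c\<le>n. ?M * (word_dist (w c (\<pi> x) (t x)) (w c (\<pi> y) (t y)) - 2)) =
        ?M * wd x y - 2 * ?M * (real n + 1)"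
      by (simp add: wd_def sum_distrib_left sum_subtractf algebra_simps)
    finally show ?thesis .
  qed
  define q where "q = 2 * \<tau> * A"
  have q: "q > 0" using \<tau> A by (simp add: q_def)
  define b1 where "b1 = ?M * E / q + 2 * ?M * (real n + 1) + ?M * ((real n + 1) * (2 * b0 / \<tau> + 4))"
  have parts: "0 \<le> ?M * E / q" "0 \<le> 2 * ?M * (real n + 1)" "0 \<le> ?M * ((real n + 1) * (2 * b0 / \<tau> + 4))"
    using E q b0(1) \<tau> by (auto intro!: mult_nonneg_nonneg divide_nonneg_nonneg add_nonneg_nonneg)
  have bounds: "?M / q * dist x y - b1 \<le> tree_power_dist n (f x) (f y) \<and>
      tree_power_dist n (f x) (f y) \<le> ?M * ((real n + 1) / \<tau>) * dist x y + b1" for x y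
  proof
    have "?M / q * dist x y \<le> ?M / q * (q * wd x y + E)"
      using wd_lower[of x y, folded q_def] q by (intro mult_left_mono) auto
    also have "\<dots> = ?M * wd x y + ?M * E / q" using q by (simp add: field_simps)
    finally show "?M / q * dist x y - b1 \<le> tree_power_dist n (f x) (f y)"
      using f_lower[of x y] parts by (simp add: b1_def)
    have "tree_power_dist n (f x) (f y) \<le> ?M * wd x y" by (rule f_upper)
    also have "\<dots> \<le> ?M * ((real n + 1) / \<tau> * dist x y + (real n + 1) * (2 * b0 / \<tau> + 4))"
      using wd_upper by (intro mult_left_mono) auto
    also have "\<dots> = ?M * ((real n + 1) / \<tau>) * dist x y + ?M * ((real n + 1) * (2 * b0 / \<tau> + 4))"
      by (simp only: distrib_left mult.assoc)
    finally show "tree_power_dist n (f x) (f y) \<le> ?M * ((real n + 1) / \<tau>) * dist x y + b1"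
      using parts unfolding b1_def by linarith
  qed
  have "?M / q > 0" "?M * ((real n + 1) / \<tau>) > 0" "b1 \<ge> 0"
    using N q \<tau> parts by (auto simp: b1_def)
  then have "qi_embedding f (tree_power n) (tree_power_dist n)"
    unfolding qi_embedding_def using in_tree bounds
    by (intro conjI allI exI[of _ "?M / q"] exI[of _ "?M * ((real n + 1) / \<tau>)"] exI[of _ b1]) blast+
  then show ?thesis by blast
qed

end
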